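(* Let $\mathbb{F}$ be any field and let $p\in\mathbb{F}[x_1,\dots,x_n]$ be computed by a simple, minimal, nonzero $\Sigma\Pi\Sigma(k,d)$ circuit (where the multiplication terms may have different degrees, $d$ being an upper bound on the degree). Let $L(p)$ be the set of linear factors of $p$, i.e. the irreducible factors of $p$ that are linear. Then the rank of $L(p)$ (the dimension of the span of its elements) is at most $k^3\log d$.
   Context: A $\Sigma\Pi\Sigma$ circuit is an expression $C=\sum_{i=1}^k T_i$ where each $T_i$ is a nonzero constant times a product of linear forms; $k$ is the top fanin. $C$ is simple if no nonzero linear form divides all $T_i$; $C$ is minimal if for every proper subset $S\subsetneq[k]$, $\sum_{i\in S}T_i\neq0$.
   Formalization: The bound is proved for d ≥ 2 (log to base 2): for d = 1 it would be 0, yet p = x_1 + x_2 with k = 2 is simple, minimal and nonzero and has rank of L(p) equal to 1; for d = 0 the logarithm is undefined. *)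

theory Defs
  imports
    Complex_Main
    "HOL-Library.Poly_Mapping"
    "HOL-Computational_Algebra.Factorial_Ring"
begin

text \<open>
  The ring \<open>F[x\<^sub>1, \<dots>, x\<^sub>n]\<close>, with the variables indexed by the elements of a finite
  linearly ordered type \<open>'n\<close>; the order makes the ring an instance of \<^class>\<open>idom\<close>.
\<close>

type_synonym ('n, 'a) mpoly = "('n \<Rightarrow>\<^sub>0 nat) \<Rightarrow>\<^sub>0 'a"

definition Const :: "'a::field \<Rightarrow> ('n::{finite,linorder}, 'a) mpoly" where
  "Const c = Poly_Mapping.single 0 c"

definition Var :: "'n::{finite,linorder} \<Rightarrow> ('n, 'a::field) mpoly" where
  "Var i = Poly_Mapping.single (Poly_Mapping.single i 1) 1"

definition scale :: "'a::field \<Rightarrow> ('n::{finite,linorder}, 'a) mpoly \<Rightarrow> ('n, 'a) mpoly" where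
  "scale c p = Const c * p"

definition total_degree :: "('n::{finite,linorder}, 'a::field) mpoly \<Rightarrow> nat" where
  "total_degree p =
     Max (insert 0 ((\<lambda>m. \<Sum>i\<in>UNIV. Poly_Mapping.lookup m i) ` Poly_Mapping.keys p))"

text \<open>Linear forms are homogeneous; the zero form is included.\<close>

definition linear_form :: "('n::{finite,linorder}, 'a::field) mpoly \<Rightarrow> bool" where
  "linear_form l \<longleftrightarrow> (\<exists>a. l = (\<Sum>i\<in>UNIV. Const (a i) * Var i))"

text \<open>
  A multiplication term is a pair of a constant and the list, with multiplicities, of its
  linear forms. A circuit is the list of its multiplication terms.
\<close>

type_synonym ('n, 'a) mult_term = "'a \<times> ('n, 'a) mpoly list"
type_synonym ('n, 'a) circuit = "('n, 'a) mult_term list"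

definition term_poly :: "('n::{finite,linorder}, 'a::field) mult_term \<Rightarrow> ('n, 'a) mpoly" where
  "term_poly T = Const (fst T) * prod_list (snd T)"

definition circuit_poly :: "('n::{finite,linorder}, 'a::field) circuit \<Rightarrow> ('n, 'a) mpoly" where
  "circuit_poly C = (\<Sum>i<length C. term_poly (C ! i))"

text \<open>
  \<open>\<Sigma>\<Pi>\<Sigma>(k, d)\<close> circuits: the terms may have different degrees, all bounded by \<open>d\<close>.
\<close>

definition SPS_circuit ::
    "nat \<Rightarrow> nat \<Rightarrow> ('n::{finite,linorder}, 'a::field) circuit \<Rightarrow> bool" where
  "SPS_circuit k d C \<longleftrightarrow>
     length C = k \<and>
     (\<forall>T\<in>set C. fst T \<noteq> 0 \<and> (\<forall>l\<in>set (snd T). linear_form l) \<and> length (snd T) \<le> d)"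

definition simple_circuit :: "('n::{finite,linorder}, 'a::field) circuit \<Rightarrow> bool" where
  "simple_circuit C \<longleftrightarrow>
     \<not> (\<exists>l. linear_form l \<and> l \<noteq> 0 \<and> (\<forall>i<length C. l dvd term_poly (C ! i)))"

text \<open>The empty subset has to be left out, as its sum is always zero.\<close>

definition minimal_circuit :: "('n::{finite,linorder}, 'a::field) circuit \<Rightarrow> bool" where
  "minimal_circuit C \<longleftrightarrow>
     (\<forall>S. S \<subset> {..<length C} \<and> S \<noteq> {} \<longrightarrow> (\<Sum>i\<in>S. term_poly (C ! i)) \<noteq> 0)"

text \<open>
  The factors of total degree one. A sum of products of linear forms need not be homogeneous,
  so these may have a constant term.
\<close>

definition linear_factors ::
    "('n::{finite,linorder}, 'a::field) mpoly \<Rightarrow> ('n, 'a) mpoly set" where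
  "linear_factors p = {l. irreducible l \<and> total_degree l = 1 \<and> l dvd p}"

lemma vector_space_scale:
  "vector_space (scale :: 'a::field \<Rightarrow> ('n::{finite,linorder}, 'a) mpoly \<Rightarrow> _)"
  by unfold_locales
    (simp_all add: scale_def Const_def algebra_simps single_add mult_single
      flip: mult.assoc)

text \<open>
  The dimension of the span. (\<^term>\<open>vector_space.dim\<close> is \<open>0\<close> on subspaces of infinite
  dimension, but \<^term>\<open>linear_factors p\<close> lies in the span of \<open>1\<close> and the finitely many
  variables.)
\<close>

definition rank :: "('n::{finite,linorder}, 'a::field) mpoly set \<Rightarrow> nat" where
  "rank A = vector_space.dim scale A"

end

theory Submission
  imports Defs "HOL-Library.Multiset"
begin

text \<open>
  Call two terms equivalent outside a space \<open>U\<close> of affine forms if, up to scalars, they have the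
  same factors outside \<open>U\<close>. We enlarge \<open>U\<close>, starting from the constants, until it contains all
  linear factors of \<open>p\<close>.

  Let \<open>l\<close> be a linear factor outside \<open>U\<close>. Modulo \<open>l\<close> the circuit vanishes. As long as the
  surviving terms differ in the multiplicity of some form \<open>m\<close> outside \<open>U\<close>, keep only the terms of
  lowest order in \<open>m\<close>, divide by that power of \<open>m\<close> and reduce modulo \<open>m\<close>. After fewer than \<open>k\<close> such
  reductions, let \<open>I\<close> be the space spanned by the forms that were killed; it is independent of
  \<open>U\<close>. The surviving terms now agree outside \<open>U\<close>, so the original ones are matched modulo \<open>I\<close>
  outside \<open>U + I\<close>. They are not all equivalent outside \<open>U\<close>: otherwise the relation between their
  reductions would be a multiple of a relation between the surviving terms of the circuit,
  contradicting minimality. So some inequivalent pair is matched modulo \<open>I\<close>, and we replace \<open>U\<close>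
  by \<open>U + I\<close>, whose dimension is larger by at most \<open>k\<close>.

  If the pair becomes equivalent outside \<open>U + I\<close>, two classes merge, which happens at most \<open>k - 1\<close>
  times. Otherwise the number of factors of the pair in each class modulo \<open>U\<close> that contains an
  unmatched factor doubles, which happens at most \<open>1 + log d\<close> times for each of the
  \<open>k (k - 1) / 2\<close> pairs.
\<close>

subsection \<open>Vectors up to scalars, modulo a subspace\<close>

locale coset_counting = vector_space
begin

text \<open>For a subspace \<open>I\<close>, the class of \<open>x\<close> modulo \<open>I\<close>
  up to nonzero scalars: a projective point of the quotient, or \<open>I\<close> itself if
  \<open>x\<close> lies in \<open>I\<close>. For \<open>I = {0}\<close> and
  \<open>x \<noteq> 0\<close> it is the line of \<open>x\<close> without the origin.\<close>

definition proj_coset :: "'b set \<Rightarrow> 'b \<Rightarrow> 'b set" where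
  "proj_coset I x = {y. \<exists>c. c \<noteq> 0 \<and> y - c *s x \<in> I}"

definition coset_count :: "'b set \<Rightarrow> 'b multiset \<Rightarrow> 'b \<Rightarrow> nat" where
  "coset_count I A x = size (filter_mset (\<lambda>a. a \<in> proj_coset I x) A)"

text \<open>A normal form up to scalars, which turns agreement up to scalars into equality of
  multisets.\<close>

definition line_rep :: "'b \<Rightarrow> 'b" where
  "line_rep x = (SOME y. y \<in> proj_coset {0} x)"

lemma proj_coset_refl:
  assumes "subspace I"
  shows "x \<in> proj_coset I x"
  unfolding proj_coset_def using assms subspace_0 by (auto intro!: exI[of _ 1])

lemma proj_coset_zero_iff: "y \<in> proj_coset {0} x \<longleftrightarrow> (\<exists>c. c \<noteq> 0 \<and> y = c *s x)"
  by (auto simp: proj_coset_def)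

lemma proj_coset_mono: "I \<subseteq> J \<Longrightarrow> proj_coset I x \<subseteq> proj_coset J x"
  by (auto simp: proj_coset_def)

lemma proj_coset_trans:
  assumes I: "subspace I" and "y \<in> proj_coset I x" "z \<in> proj_coset I y"
  shows "z \<in> proj_coset I x"
proof -
  obtain c d where c: "c \<noteq> 0" "y - c *s x \<in> I" and d: "d \<noteq> 0" "z - d *s y \<in> I"
    using assms by (auto simp: proj_coset_def)
  have "(z - d *s y) + d *s (y - c *s x) \<in> I"
    using I c d by (intro subspace_add subspace_scale)
  then have "z - (d * c) *s x \<in> I"
    by (simp add: scale_right_diff_distrib)
  then show ?thesis
    using c d by (auto simp: proj_coset_def intro!: exI[of _ "d * c"])
qed

lemma proj_coset_sym:
  assumes I: "subspace I" and "y \<in> proj_coset I x"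
  shows "x \<in> proj_coset I y"
proof -
  obtain c where c: "c \<noteq> 0" "y - c *s x \<in> I"
    using assms by (auto simp: proj_coset_def)
  have "(- inverse c) *s (y - c *s x) \<in> I"
    using I c by (intro subspace_scale)
  then have "x - inverse c *s y \<in> I"
    using c by (simp add: scale_right_diff_distrib)
  then show ?thesis
    using c by (auto simp: proj_coset_def intro!: exI[of _ "inverse c"])
qed

lemma proj_coset_eq:
  assumes "subspace I" "y \<in> proj_coset I x"
  shows "proj_coset I y = proj_coset I x"
  using proj_coset_trans[OF assms] proj_coset_trans[OF assms(1) proj_coset_sym[OF assms]]
  by (intro subset_antisym subsetI)

lemma proj_coset_line:
  assumes I: "subspace I" and "y \<in> proj_coset I x" "z \<in> proj_coset {0} y"
  shows "z \<in> proj_coset I x"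
  using assms proj_coset_mono[of "{0}" I y] proj_coset_trans[OF I, of y x z] subspace_0[OF I] by auto

lemma proj_coset_avoids:
  assumes W: "subspace W" and "I \<subseteq> W" "y \<in> proj_coset I x" "x \<notin> W"
  shows "y \<notin> W"
proof
  assume y: "y \<in> W"
  obtain c where c: "c \<noteq> 0" "y - c *s x \<in> W"
    using assms by (auto simp: proj_coset_def)
  have "y - (y - c *s x) \<in> W"
    by (rule subspace_diff[OF W y c(2)])
  then have "c *s x \<in> W" by simp
  then have "inverse c *s (c *s x) \<in> W"
    by (rule subspace_scale[OF W])
  then show False using c assms by simp
qed

section \<open>Line representatives and counting over classes\<close>

lemma line_rep: "line_rep x \<in> proj_coset {0} x"
  unfolding line_rep_def by (rule someI[of _ x]) (simp add: proj_coset_refl)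

lemma line_rep_eq_iff: "line_rep y = line_rep x \<longleftrightarrow> y \<in> proj_coset {0} x"
proof
  assume "line_rep y = line_rep x"
  then have "line_rep x \<in> proj_coset {0} y"
    using line_rep[of y] by simp
  then show "y \<in> proj_coset {0} x"
    by (rule proj_coset_trans[OF subspace_single_0 line_rep proj_coset_sym[OF subspace_single_0]])
next
  assume "y \<in> proj_coset {0} x"
  then have "proj_coset {0} y = proj_coset {0} x"
    by (intro proj_coset_eq subspace_single_0)
  then show "line_rep y = line_rep x"
    by (simp add: line_rep_def)
qed

text \<open>As \<open>P\<close> is constant along lines, the multiplicity of a representative is
  either zero on both sides or the count over one whole line.\<close>

lemma image_line_rep_eqI:
  assumes P: "\<And>x y. P x \<Longrightarrow> y \<in> proj_coset {0} x \<Longrightarrow> P y"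
    and eq: "\<And>x. P x \<Longrightarrow> coset_count {0} A x = coset_count {0} B x"
  shows "image_mset line_rep (filter_mset P A) = image_mset line_rep (filter_mset P B)"
proof (rule multiset_eqI)
  fix z
  have count: "count (image_mset line_rep (filter_mset P C)) z =
      size (filter_mset (\<lambda>a. P a \<and> line_rep a = z) C)" for C
    by (induction C) auto
  show "count (image_mset line_rep (filter_mset P A)) z =
      count (image_mset line_rep (filter_mset P B)) z"
  proof (cases "\<exists>x. P x \<and> line_rep x = z")
    case True
    then obtain x where x: "P x" "line_rep x = z" by blast
    have "(\<lambda>a. P a \<and> line_rep a = z) = (\<lambda>a. a \<in> proj_coset {0} x)"
      using x P by (auto simp: line_rep_eq_iff)
    then show ?thesis
      unfolding count using eq[OF x(1)] by (simp add: coset_count_def)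
  next
    case False
    then have "(\<lambda>a. P a \<and> line_rep a = z) = (\<lambda>a. False)" by auto
    then show ?thesis unfolding count by simp
  qed
qed

text \<open>A class modulo \<open>I\<close> is a disjoint union of lines. If all of them except that
  of \<open>x\<close> were balanced, subtracting them from the equal totals would balance the line
  of \<open>x\<close> too.\<close>

lemma exists_unbalanced_line:
  assumes I: "subspace I"
    and eq: "coset_count I A x = coset_count I B x"
    and neq: "coset_count {0} A x \<noteq> coset_count {0} B x"
  shows "\<exists>y \<in> proj_coset I x - proj_coset {0} x. coset_count {0} A y \<noteq> coset_count {0} B y"
proof (rule ccontr)
  assume "\<not> ?thesis"
  then have bal: "coset_count {0} A y = coset_count {0} B y"
    if "y \<in> proj_coset I x" "y \<notin> proj_coset {0} x" for y
    using that by blast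
  let ?P = "\<lambda>y. y \<in> proj_coset I x \<and> y \<notin> proj_coset {0} x"
  have img: "image_mset line_rep (filter_mset ?P A) = image_mset line_rep (filter_mset ?P B)"
  proof (rule image_line_rep_eqI)
    fix y z assume y: "?P y" and z: "z \<in> proj_coset {0} y"
    have "z \<in> proj_coset I x"
      by (rule proj_coset_line[OF I _ z]) (use y in blast)
    moreover have "z \<notin> proj_coset {0} x"
      using y proj_coset_trans[OF subspace_single_0 _ proj_coset_sym[OF subspace_single_0 z]] by blast
    ultimately show "?P z" by blast
  next
    fix y assume "?P y"
    then show "coset_count {0} A y = coset_count {0} B y" using bal by blast
  qed
  have sz: "size (filter_mset ?P A) = size (filter_mset ?P B)"
    using arg_cong[OF img, of size] by (simp only: size_image_mset)
  have "proj_coset {0} x \<subseteq> proj_coset I x"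
    using subspace_0[OF I] by (intro proj_coset_mono) simp
  then have "coset_count I C x = coset_count {0} C x + size (filter_mset ?P C)" for C
    unfolding coset_count_def by (induction C) auto
  then show False using sz eq neq by simp
qed

text \<open>
  A vector that is unbalanced between \<open>A\<close> and \<open>B\<close> has an unbalanced partner in its class
  modulo \<open>I\<close>; the two lie in different classes modulo \<open>U\<close>, as \<open>U\<close> and \<open>I\<close> are independent.
\<close>

lemma coset_count_doubling:
  assumes U: "subspace U" and I: "subspace I" and W: "subspace W"
    and sub: "U \<subseteq> W" "I \<subseteq> W" and UI: "U \<inter> I \<subseteq> {0}" and x: "x \<notin> W"
    and neq: "coset_count {0} A x \<noteq> coset_count {0} B x"
    and eq: "coset_count I A x = coset_count I B x"
    and N: "\<And>y. y \<notin> U \<Longrightarrow> coset_count {0} A y \<noteq> coset_count {0} B y \<Longrightarrow> N \<le> coset_count U (A + B) y"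
  shows "2 * N \<le> coset_count W (A + B) x"
proof -
  obtain y where y: "y \<in> proj_coset I x" "y \<notin> proj_coset {0} x"
    "coset_count {0} A y \<noteq> coset_count {0} B y"
    using exists_unbalanced_line[OF I eq neq] by blast
  have yW: "y \<notin> W"
    by (rule proj_coset_avoids[OF W sub(2) y(1) x])
  \<comment> \<open>Otherwise \<open>y - c x\<close> lies in \<open>U\<close> and
    \<open>y - d x\<close> in \<open>I\<close>. As \<open>x\<close> is outside \<open>W\<close>,
    this forces \<open>c = d\<close>, and then \<open>U \<inter> I \<subseteq> {0}\<close> puts
    \<open>y\<close> on the line of \<open>x\<close>.\<close>
  have yU: "y \<notin> proj_coset U x"
  proof
    assume "y \<in> proj_coset U x"
    then obtain c where c: "c \<noteq> 0" "y - c *s x \<in> U" by (auto simp: proj_coset_def)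
    obtain d where d: "d \<noteq> 0" "y - d *s x \<in> I" using y(1) by (auto simp: proj_coset_def)
    have "(y - c *s x) - (y - d *s x) \<in> W"
      by (rule subspace_diff[OF W]) (use c d sub in blast)+
    then have cd: "(d - c) *s x \<in> W" by (simp add: scale_left_diff_distrib)
    have "c = d"
    proof (rule ccontr)
      assume "c \<noteq> d"
      then have "inverse (d - c) *s ((d - c) *s x) = x" by simp
      then show False using subspace_scale[OF W cd, of "inverse (d - c)"] x by simp
    qed
    then have "y - c *s x \<in> {0}" using c(2) d(2) UI by blast
    then have "y = c *s x" by simp
    then show False using c y(2) by (auto simp: proj_coset_zero_iff)
  qed
  have disj: "proj_coset U x \<inter> proj_coset U y = {}"
    using yU proj_coset_trans[OF U _ proj_coset_sym[OF U]] by blast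
  have "proj_coset U x \<subseteq> proj_coset W x"
    by (rule proj_coset_mono[OF sub(1)])
  moreover have "proj_coset U y \<subseteq> proj_coset W x"
  proof -
    have "y \<in> proj_coset W x" using y(1) proj_coset_mono[OF sub(2)] by blast
    then show ?thesis using proj_coset_eq[OF W] proj_coset_mono[OF sub(1), of y] by blast
  qed
  ultimately have "coset_count U C x + coset_count U C y \<le> coset_count W C x" for C
    unfolding coset_count_def using disj by (induction C) auto
  moreover have "N \<le> coset_count U (A + B) x" "N \<le> coset_count U (A + B) y"
    using N neq y(3) x yW sub by auto
  ultimately show ?thesis
    by (smt (verit) add_mono le_trans mult_2)
qed

section \<open>Profiles: terms up to equivalence outside a subspace\<close>

lemma coset_count_mono: "I \<subseteq> J \<Longrightarrow> coset_count I A x \<le> coset_count J A x"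
  unfolding coset_count_def using proj_coset_mono[of I J x]
  by (induction A) auto

lemma coset_count_le_size: "coset_count I A x \<le> size A"
  unfolding coset_count_def by (intro size_mset_mono) simp

text \<open>Encodes the equivalence class of a term outside \<open>U\<close> as a function, so that
  the number of classes is the cardinality of an image.\<close>

definition profile :: "'b set \<Rightarrow> 'b multiset \<Rightarrow> 'b \<Rightarrow> nat" where
  "profile U A x = (if x \<in> U then 0 else coset_count {0} A x)"

lemma profile_eq_iff:
  "profile U A = profile U B \<longleftrightarrow> (\<forall>x. x \<notin> U \<longrightarrow> coset_count {0} A x = coset_count {0} B x)"
  by (auto simp: profile_def fun_eq_iff)

lemma profile_coarsen:
  assumes "U \<subseteq> U'"
  shows "profile U' A = (\<lambda>x. if x \<in> U' then 0 else profile U A x)"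
  using assms by (intro ext) (auto simp: profile_def)

text \<open>Enlarging \<open>U\<close> only erases more values, so the new profiles are the image of
  the old ones under a single map.\<close>

lemma card_profile_mono:
  assumes "U \<subseteq> U'"
  shows "card ((\<lambda>i. profile U' (T i)) ` {..<k::nat}) \<le> card ((\<lambda>i. profile U (T i)) ` {..<k})"
proof -
  have "(\<lambda>i. profile U' (T i)) ` {..<k} =
      (\<lambda>f x. if x \<in> U' then 0 else f x) ` (\<lambda>i. profile U (T i)) ` {..<k}"
    by (simp add: image_image profile_coarsen[OF assms])
  then show ?thesis by (simp add: card_image_le)
qed

text \<open>Two distinct profiles that merge show that the erasing map is not injective.\<close>

lemma card_profile_less:
  assumes sub: "U \<subseteq> U'" and ij: "i < k" "j < k"
    and neq: "profile U (T i) \<noteq> profile U (T j)" and eq: "profile U' (T i) = profile U' (T j)"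
  shows "card ((\<lambda>i. profile U' (T i)) ` {..<k::nat}) < card ((\<lambda>i. profile U (T i)) ` {..<k})"
proof -
  let ?P = "(\<lambda>i. profile U (T i)) ` {..<k}"
  let ?g = "\<lambda>f x. if x \<in> U' then 0 else f x :: nat"
  have img: "(\<lambda>i. profile U' (T i)) ` {..<k} = ?g ` ?P"
    by (simp add: image_image profile_coarsen[OF sub])
  have "\<not> inj_on ?g ?P"
  proof
    assume "inj_on ?g ?P"
    moreover have "?g (profile U (T i)) = ?g (profile U (T j))"
      using eq unfolding profile_coarsen[OF sub] .
    ultimately show False using neq ij unfolding inj_on_def by blast
  qed
  then have "card (?g ` ?P) \<noteq> card ?P" by (auto dest: eq_card_imp_inj_on[rotated])
  moreover have "card (?g ` ?P) \<le> card ?P" by (rule card_image_le) simp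
  ultimately show ?thesis unfolding img by simp
qed

end

subsection \<open>Affine forms and substitution\<close>

global_interpretation vs: coset_counting "scale :: 'a::field \<Rightarrow> ('n::{finite,linorder}, 'a) mpoly \<Rightarrow> _"
  by (intro coset_counting.intro vector_space_scale)

lemma Const_0 [simp]: "Const 0 = 0"
  and Const_1 [simp]: "Const 1 = 1"
  by (simp_all add: Const_def)

lemma Const_add: "Const (a + b) = Const a + Const b"
  by (simp add: Const_def single_add)

lemma Const_mult: "Const (a * b) = Const a * Const b"
  by (simp add: Const_def mult_single)

lemma Const_eq_0_iff [simp]: "Const c = 0 \<longleftrightarrow> c = 0"
  by (metis Const_0 Const_def lookup_single_eq lookup_zero)

lemma scale_one: "scale c 1 = Const c"
  by (simp add: scale_def)

lemma scale_Const: "scale c (Const a) = Const (c * a)"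
  by (simp add: scale_def Const_mult)

lemma mult_scale_left: "scale c p * q = scale c (p * q)"
  and mult_scale_right: "p * scale c q = scale c (p * q)"
  by (simp_all add: scale_def mult_ac)

definition affine_forms :: "('n::{finite,linorder}, 'a::field) mpoly set" where
  "affine_forms = vs.span (insert 1 (range Var))"

lemma subspace_affine_forms: "vs.subspace affine_forms"
  by (simp add: affine_forms_def vs.subspace_span)

lemma one_in_affine_forms: "1 \<in> affine_forms"
  by (simp add: affine_forms_def vs.span_base)

lemma Var_in_affine_forms: "Var i \<in> affine_forms"
  by (simp add: affine_forms_def vs.span_base)

lemma linear_form_in_affine_forms:
  assumes "linear_form l"
  shows "l \<in> affine_forms"
proof -
  obtain a where "l = (\<Sum>i\<in>UNIV. scale (a i) (Var i))"
    using assms by (auto simp: linear_form_def scale_def)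
  then show ?thesis
    by (auto intro!: vs.subspace_sum vs.subspace_scale subspace_affine_forms Var_in_affine_forms)
qed

lemma linear_form_scale:
  assumes "linear_form l"
  shows "linear_form (scale c l)"
proof -
  obtain a where "l = (\<Sum>i\<in>UNIV. Const (a i) * Var i)"
    using assms by (auto simp: linear_form_def)
  then have "scale c l = (\<Sum>i\<in>UNIV. Const (c * a i) * Var i)"
    by (simp add: scale_def sum_distrib_left Const_mult mult.assoc)
  then show ?thesis
    unfolding linear_form_def by (rule exI[of _ "\<lambda>i. c * a i"])
qed

lemma mpoly_induct [case_names zero add_single]:
  fixes p :: "('n::{finite,linorder}, 'a::field) mpoly"
  assumes "P 0" and "\<And>p m c. P p \<Longrightarrow> P (p + Poly_Mapping.single m c)"
  shows "P p"
proof (induction p rule: update_induct)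
  case const
  show ?case by (fact assms(1))
next
  case (update f a b)
  have "Poly_Mapping.update a b f = f + Poly_Mapping.single a b"
    using update
    by (intro poly_mapping_eqI)
      (auto simp: lookup_update lookup_add lookup_single when_def in_keys_iff)
  then show ?case
    using assms(2) update by simp
qed

lemma mpoly_eq_sum_single:
  fixes p :: "('n::{finite,linorder}, 'a::field) mpoly"
  shows "p = (\<Sum>m\<in>Poly_Mapping.keys p. Poly_Mapping.single m (Poly_Mapping.lookup p m))"
  by (intro poly_mapping_eqI)
    (auto simp: lookup_sum lookup_single when_def in_keys_iff)

text \<open>Every monomial of \<open>l\<close> has degree at most one, hence is \<open>1\<close> or
  a variable.\<close>

lemma total_degree_one_in_affine_forms:
  fixes l :: "('n::{finite,linorder}, 'a::field) mpoly"
  assumes "total_degree l = 1"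
  shows "l \<in> affine_forms"
proof -
  have "Poly_Mapping.single m (Poly_Mapping.lookup l m) \<in> affine_forms" if m: "m \<in> Poly_Mapping.keys l" for m
  proof -
    have "(\<Sum>i\<in>UNIV. Poly_Mapping.lookup m i) \<le> total_degree l"
      using m unfolding total_degree_def by (intro Max_ge) auto
    then have le: "(\<Sum>i\<in>UNIV. Poly_Mapping.lookup m i) \<le> 1"
      using assms by simp
    show ?thesis
    proof (cases "m = 0")
      case True
      then have "Poly_Mapping.single m (Poly_Mapping.lookup l m) = scale (Poly_Mapping.lookup l m) 1"
        by (simp add: scale_one Const_def)
      then show ?thesis
        by (simp add: vs.subspace_scale subspace_affine_forms one_in_affine_forms)
    next
      case False
      then obtain i where i: "Poly_Mapping.lookup m i \<noteq> 0"
        by (metis lookup_zero poly_mapping_eqI)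
      have "(\<Sum>j\<in>UNIV. Poly_Mapping.lookup m j) = Poly_Mapping.lookup m i + (\<Sum>j\<in>UNIV - {i}. Poly_Mapping.lookup m j)"
        by (simp add: sum.remove)
      then have mi: "Poly_Mapping.lookup m i = 1" and "(\<Sum>j\<in>UNIV - {i}. Poly_Mapping.lookup m j) = 0"
        using le i by linarith+
      then have mj: "Poly_Mapping.lookup m j = 0" if "j \<noteq> i" for j
        using that by auto
      have "m = Poly_Mapping.single i 1"
        by (rule poly_mapping_eqI) (use mi mj in \<open>auto simp: lookup_single when_def\<close>)
      then have "Poly_Mapping.single m (Poly_Mapping.lookup l m) = scale (Poly_Mapping.lookup l m) (Var i)"
        by (simp add: scale_def Const_def Var_def mult_single)
      then show ?thesis
        by (simp add: vs.subspace_scale subspace_affine_forms Var_in_affine_forms)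
    qed
  qed
  then have "(\<Sum>m\<in>Poly_Mapping.keys l. Poly_Mapping.single m (Poly_Mapping.lookup l m)) \<in> affine_forms"
    by (intro vs.subspace_sum subspace_affine_forms)
  then show ?thesis
    by (subst mpoly_eq_sum_single)
qed

section \<open>Substitution as a ring endomorphism\<close>

definition monom_subst ::
    "('n::{finite,linorder} \<Rightarrow> ('n, 'a::field) mpoly) \<Rightarrow> ('n \<Rightarrow>\<^sub>0 nat) \<Rightarrow> ('n, 'a) mpoly" where
  "monom_subst \<sigma> m = (\<Prod>i\<in>UNIV. \<sigma> i ^ Poly_Mapping.lookup m i)"

definition poly_subst ::
    "('n::{finite,linorder} \<Rightarrow> ('n, 'a::field) mpoly) \<Rightarrow> ('n, 'a) mpoly \<Rightarrow> ('n, 'a) mpoly" where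
  "poly_subst \<sigma> p = (\<Sum>m\<in>Poly_Mapping.keys p. Const (Poly_Mapping.lookup p m) * monom_subst \<sigma> m)"

lemma monom_subst_add: "monom_subst \<sigma> (m + n) = monom_subst \<sigma> m * monom_subst \<sigma> n"
  by (simp add: monom_subst_def lookup_add power_add prod.distrib)

lemma poly_subst_superset:
  assumes "finite K" "Poly_Mapping.keys p \<subseteq> K"
  shows "poly_subst \<sigma> p = (\<Sum>m\<in>K. Const (Poly_Mapping.lookup p m) * monom_subst \<sigma> m)"
  unfolding poly_subst_def
  by (rule sum.mono_neutral_left) (use assms in \<open>auto simp: in_keys_iff\<close>)

lemma poly_subst_zero [simp]: "poly_subst \<sigma> 0 = 0"
  by (simp add: poly_subst_def)

lemma poly_subst_single: "poly_subst \<sigma> (Poly_Mapping.single m c) = Const c * monom_subst \<sigma> m"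
  by (simp add: poly_subst_def)

lemma poly_subst_add: "poly_subst \<sigma> (p + q) = poly_subst \<sigma> p + poly_subst \<sigma> q"
proof -
  let ?K = "Poly_Mapping.keys p \<union> Poly_Mapping.keys q"
  have "poly_subst \<sigma> r = (\<Sum>m\<in>?K. Const (Poly_Mapping.lookup r m) * monom_subst \<sigma> m)"
    if "r \<in> {p, q, p + q}" for r
    by (rule poly_subst_superset) (use that keys_add[of p q] in auto)
  then show ?thesis
    by (simp add: lookup_add Const_add distrib_right sum.distrib)
qed

lemma poly_subst_mult: "poly_subst \<sigma> (p * q) = poly_subst \<sigma> p * poly_subst \<sigma> q"
proof (induction p rule: mpoly_induct)
  case zero
  show ?case by simp
next
  case (add_single p m c)
  have "poly_subst \<sigma> (Poly_Mapping.single m c * q) = Const c * monom_subst \<sigma> m * poly_subst \<sigma> q"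
  proof (induction q rule: mpoly_induct)
    case zero
    show ?case by simp
  next
    case (add_single q n e)
    then show ?case
      by (simp add: distrib_left poly_subst_add mult_single poly_subst_single Const_mult
          monom_subst_add mult_ac)
  qed
  with add_single show ?case
    by (simp add: distrib_right poly_subst_add poly_subst_single)
qed

lemma poly_subst_Const [simp]: "poly_subst \<sigma> (Const c) = Const c"
  unfolding Const_def[of c] poly_subst_single by (simp add: monom_subst_def Const_def)

lemma poly_subst_Var [simp]: "poly_subst \<sigma> (Var i) = \<sigma> i"
proof -
  have "(\<Prod>j\<in>UNIV. \<sigma> j ^ Poly_Mapping.lookup (Poly_Mapping.single i 1) j) = (\<Prod>j\<in>UNIV. if j = i then \<sigma> j else 1)"
    by (rule prod.cong) (auto simp: lookup_single when_def)
  then show ?thesis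
    by (simp add: Var_def poly_subst_single monom_subst_def)
qed

text \<open>Reduction modulo \<open>m\<close> carried out inside the ring. Affine forms are
  projected along \<open>m\<close> onto a complement that contains \<open>span B\<close>;
  substituting the projected variables extends this to a ring homomorphism.\<close>

lemma exists_elimination_hom:
  fixes B :: "('n::{finite,linorder}, 'a::field) mpoly set"
  assumes one: "1 \<in> vs.span B" and m: "m \<in> affine_forms" "m \<notin> vs.span B"
    and B: "B \<subseteq> affine_forms"
  obtains \<psi> :: "('n, 'a) mpoly \<Rightarrow> ('n, 'a) mpoly" where
    "\<And>p q. \<psi> (p + q) = \<psi> p + \<psi> q" "\<And>p q. \<psi> (p * q) = \<psi> p * \<psi> q"
    "\<And>c. \<psi> (Const c) = Const c" "\<psi> m = 0"
    "\<And>u. u \<in> vs.span B \<Longrightarrow> \<psi> u = u"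
    "\<And>x. x \<in> affine_forms \<Longrightarrow> \<exists>c. \<psi> x = x - scale c m"
proof -
  interpret vp: vector_space_pair "scale :: 'a \<Rightarrow> ('n, 'a) mpoly \<Rightarrow> _" "(*) :: 'a \<Rightarrow> 'a \<Rightarrow> 'a"
    by (intro vector_space_pair.intro vector_space_scale) (unfold_locales, auto simp: algebra_simps)
  obtain D where D: "D \<subseteq> B" "vs.independent D" "B \<subseteq> vs.span D"
    using vs.maximal_independent_subset by blast
  have spanD: "vs.span D = vs.span B"
    using D by (metis vs.span_mono vs.span_span subset_antisym)
  have mD: "m \<notin> D" "vs.independent (insert m D)"
    using m D spanD vs.span_base[of m D] by (auto simp: vs.independent_insert)
  \<comment> \<open>\<open>g\<close> reads off the coordinate of \<open>m\<close> and vanishes on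
    \<open>span B\<close>, so \<open>\<phi>\<close> is a projection along \<open>m\<close> that
    fixes \<open>span B\<close>.\<close>
  obtain g where g: "Vector_Spaces.linear scale (*) g"
    "\<forall>x\<in>insert m D. g x = (if x = m then 1 else 0)"
    using vp.linear_independent_extend[OF mD(2), of "\<lambda>x. if x = m then 1 else 0"] by blast
  interpret g: Vector_Spaces.linear scale "(*)" g by (fact g(1))
  define \<phi> where "\<phi> x = x - scale (g x) m" for x
  define \<psi> where "\<psi> = poly_subst (\<lambda>i. \<phi> (Var i))"
  have gB: "g u = 0" if "u \<in> vs.span B" for u
  proof -
    have "u \<in> vs.span D" using that spanD by simp
    then show ?thesis
      by (induction rule: vs.span_induct_alt) (use g mD in \<open>auto simp: g.add g.scale g.zero\<close>)
  qed
  have gm: "g m = 1" using g by simp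
  have \<phi>_add: "\<phi> (x + y) = \<phi> x + \<phi> y" for x y
    by (simp add: \<phi>_def g.add vs.scale_left_distrib)
  have \<phi>_scale: "\<phi> (scale c x) = scale c (\<phi> x)" for c x
    by (simp add: \<phi>_def g.scale vs.scale_right_diff_distrib)
  have \<psi>_add: "\<psi> (p + q) = \<psi> p + \<psi> q" for p q
    by (simp add: \<psi>_def poly_subst_add)
  have \<psi>_mult: "\<psi> (p * q) = \<psi> p * \<psi> q" for p q
    by (simp add: \<psi>_def poly_subst_mult)
  have \<psi>_Const: "\<psi> (Const c) = Const c" for c
    by (simp add: \<psi>_def)
  \<comment> \<open>Both maps are linear on affine forms. They agree at the variables by
    construction, and at \<open>1\<close> because \<open>1\<close> lies in
    \<open>span B\<close>.\<close>
  have \<psi>\<phi>: "\<psi> x = \<phi> x" if "x \<in> affine_forms" for x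
    using that unfolding affine_forms_def
  proof (induction rule: vs.span_induct_alt)
    case base
    show ?case using gB[of 0] by (simp add: \<psi>_def \<phi>_def vs.span_zero)
  next
    case (step c x y)
    have "\<psi> x = \<phi> x"
      using step(1) \<psi>_Const[of 1] gB[OF one] by (auto simp: \<psi>_def \<phi>_def)
    then show ?case
      using step by (simp add: \<psi>_add \<phi>_add \<phi>_scale[unfolded scale_def] scale_def \<psi>_mult \<psi>_Const)
  qed
  have B': "vs.span B \<subseteq> affine_forms"
    by (rule vs.span_minimal[OF B subspace_affine_forms])
  show ?thesis
  proof (rule that[of \<psi>, OF \<psi>_add \<psi>_mult \<psi>_Const])
    show "\<psi> m = 0" by (simp add: \<psi>\<phi> m \<phi>_def gm)
    show "\<psi> u = u" if "u \<in> vs.span B" for u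
      using that B' by (auto simp: \<psi>\<phi> \<phi>_def gB)
    show "\<exists>c. \<psi> x = x - scale c m" if "x \<in> affine_forms" for x
      using that by (auto simp: \<psi>\<phi> \<phi>_def)
  qed
qed

subsection \<open>Degenerating a vanishing sum\<close>

text \<open>
  The function \<open>h\<close> sends a form to its reduction modulo \<open>I\<close>, represented in the complement \<open>W\<close>,
  except that a form that vanishes on the way is replaced by a nonzero scalar. So a product of
  forms never degenerates to zero.
\<close>

locale degeneration =
  fixes U I W :: "('n::{finite,linorder}, 'a::field) mpoly set"
    and h :: "('n, 'a) mpoly \<Rightarrow> ('n, 'a) mpoly"
  assumes subspace_U: "vs.subspace U" and subspace_I: "vs.subspace I" and subspace_W: "vs.subspace W"
    and U_sub_W: "U \<subseteq> W" and W_affine: "W \<subseteq> affine_forms"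
    and I_affine: "I \<subseteq> affine_forms" and W_Int_I: "W \<inter> I \<subseteq> {0}"
    and h_in_W: "x \<in> affine_forms \<Longrightarrow> h x \<in> W"
    and h_scale: "x \<in> affine_forms \<Longrightarrow> h (scale c x) = scale c (h x)"
    and h_eq_0: "x \<in> affine_forms \<Longrightarrow> h x = 0 \<Longrightarrow> x = 0"
    and h_U: "u \<in> U \<Longrightarrow> h u = u"
    and h_in_U: "x \<in> affine_forms \<Longrightarrow> x \<in> vs.span (U \<union> I) \<Longrightarrow> h x \<in> U"
    and h_cong: "x \<in> affine_forms \<Longrightarrow> x \<notin> vs.span (U \<union> I) \<Longrightarrow> h x - x \<in> I"
begin

text \<open>Outside \<open>span (U \<union> I)\<close>, \<open>h\<close> changes a form only by an
  element of \<open>I\<close>, so it cannot send that form into \<open>U\<close>.\<close>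

lemma h_in_U_iff:
  assumes "x \<in> affine_forms"
  shows "h x \<in> U \<longleftrightarrow> x \<in> vs.span (U \<union> I)"
proof
  assume hx: "h x \<in> U"
  show "x \<in> vs.span (U \<union> I)"
  proof (rule ccontr)
    assume "x \<notin> vs.span (U \<union> I)"
    then have "h x - x \<in> I" by (rule h_cong[OF assms])
    then have "h x - (h x - x) \<in> vs.span (U \<union> I)"
      using hx by (intro vs.span_diff vs.span_base) auto
    with \<open>x \<notin> vs.span (U \<union> I)\<close> show False by simp
  qed
qed (rule h_in_U[OF assms])

text \<open>Outside \<open>span (U \<union> I)\<close>, \<open>h\<close> is reduction modulo
  \<open>I\<close> with values in \<open>W\<close>. Since \<open>W\<close> meets \<open>I\<close>
  only in zero, lines in \<open>W\<close> faithfully represent classes modulo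
  \<open>I\<close>.\<close>

lemma h_proj_coset_iff:
  assumes a: "a \<in> affine_forms" and x: "x \<in> affine_forms" "x \<notin> vs.span (U \<union> I)"
  shows "h a \<in> vs.proj_coset {0} (h x) \<longleftrightarrow> a \<in> vs.proj_coset I x"
proof
  assume "h a \<in> vs.proj_coset {0} (h x)"
  then obtain c where c: "c \<noteq> 0" "h a = scale c (h x)"
    by (auto simp: vs.proj_coset_zero_iff)
  have "h a \<notin> U"
  proof
    assume "h a \<in> U"
    then have "scale (inverse c) (h a) \<in> U" by (rule vs.subspace_scale[OF subspace_U])
    with c have "h x \<in> U" by simp
    then show False using h_in_U_iff[OF x(1)] x(2) by simp
  qed
  then have "a \<notin> vs.span (U \<union> I)" using h_in_U_iff[OF a] by simp
  then have "h a - a \<in> I" by (rule h_cong[OF a])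
  moreover have "scale c (h x - x) \<in> I"
    by (intro vs.subspace_scale[OF subspace_I] h_cong[OF x])
  ultimately have "scale c (h x - x) - (h a - a) \<in> I"
    by (rule vs.subspace_diff[OF subspace_I, rotated])
  then have "a - scale c x \<in> I"
    by (simp add: c vs.scale_right_diff_distrib)
  then show "a \<in> vs.proj_coset I x"
    using c by (auto simp: vs.proj_coset_def)
next
  assume ax: "a \<in> vs.proj_coset I x"
  then obtain c where c: "c \<noteq> 0" "a - scale c x \<in> I" by (auto simp: vs.proj_coset_def)
  have "a \<notin> vs.span (U \<union> I)"
    using vs.proj_coset_avoids[OF vs.subspace_span _ ax x(2)] vs.span_superset by blast
  then have "h a - a \<in> I" by (rule h_cong[OF a])
  moreover have "scale c (h x - x) \<in> I"
    by (intro vs.subspace_scale[OF subspace_I] h_cong[OF x])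
  ultimately have "(h a - a) - scale c (h x - x) \<in> I"
    by (rule vs.subspace_diff[OF subspace_I])
  then have "((h a - a) - scale c (h x - x)) + (a - scale c x) \<in> I"
    using c(2) by (rule vs.subspace_add[OF subspace_I])
  then have "h a - scale c (h x) \<in> I"
    by (simp add: vs.scale_right_diff_distrib)
  moreover have "h a - scale c (h x) \<in> W"
    using a x by (intro vs.subspace_diff[OF subspace_W] vs.subspace_scale[OF subspace_W] h_in_W)
  ultimately have "h a - scale c (h x) = 0" using W_Int_I by blast
  then show "h a \<in> vs.proj_coset {0} (h x)"
    using c by (auto simp: vs.proj_coset_zero_iff)
qed

lemma coset_count_image:
  assumes "set_mset A \<subseteq> affine_forms" "x \<in> affine_forms" "x \<notin> vs.span (U \<union> I)"
  shows "vs.coset_count {0} (image_mset h A) (h x) = vs.coset_count I A x"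
proof -
  have "vs.coset_count {0} (image_mset h A) (h x) =
      size (filter_mset (\<lambda>a. h a \<in> vs.proj_coset {0} (h x)) A)"
    by (simp add: vs.coset_count_def filter_mset_image_mset)
  also have "filter_mset (\<lambda>a. h a \<in> vs.proj_coset {0} (h x)) A =
      filter_mset (\<lambda>a. a \<in> vs.proj_coset I x) A"
    by (rule filter_mset_cong) (use assms h_proj_coset_iff in auto)
  finally show ?thesis by (simp add: vs.coset_count_def)
qed

text \<open>Carries agreement of the reduced terms back to the original ones through
  \<open>coset_count_image\<close>. If \<open>x\<close> is not affine, its class contains no affine
  form and both counts are zero.\<close>

lemma matched_if_equal_counts:
  assumes A: "set_mset A \<subseteq> affine_forms" and B: "set_mset B \<subseteq> affine_forms"
    and eq: "\<And>m. m \<in> W \<Longrightarrow> m \<notin> U \<Longrightarrow>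
      vs.coset_count {0} (image_mset h A) m = vs.coset_count {0} (image_mset h B) m"
    and x: "x \<notin> vs.span (U \<union> I)"
  shows "vs.coset_count I A x = vs.coset_count I B x"
proof (cases "x \<in> affine_forms")
  case True
  then have "h x \<in> W" "h x \<notin> U" using h_in_W h_in_U_iff x by auto
  then show ?thesis
    using eq[of "h x"] coset_count_image[OF A True x] coset_count_image[OF B True x] by simp
next
  case False
  have "vs.coset_count I D x = 0" if "set_mset D \<subseteq> affine_forms" for D
    using vs.proj_coset_avoids[OF subspace_affine_forms I_affine _ False] that
    by (auto simp: vs.coset_count_def filter_mset_eq_conv)
  then show ?thesis using A B by simp
qed

end

text \<open>The starting point, before any form has been killed.\<close>

lemma degeneration_id:
  assumes "vs.subspace U" "U \<subseteq> affine_forms"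
  shows "degeneration U {0} affine_forms id"
  using assms
  by unfold_locales
    (auto simp: subspace_affine_forms vs.subspace_0 Un_commute[of U] vs.span_eq_iff[THEN iffD2])

text \<open>
  Passing to the part of lowest order in \<open>m\<close>: the forms divisible by \<open>m\<close> contribute only a
  scalar, and the others are reduced modulo \<open>m\<close>.
\<close>

lemma degeneration_step:
  fixes T :: "nat \<Rightarrow> ('n::{finite,linorder}, 'a::field) mpoly multiset"
  assumes deg: "degeneration U I W h" and one: "1 \<in> U" and mW: "m \<in> W" and mU: "m \<notin> U"
    and S: "finite S" "\<And>i. i \<in> S \<Longrightarrow> v \<le> vs.coset_count {0} (image_mset h (T i)) m"
    and T: "\<And>i. i \<in> S \<Longrightarrow> set_mset (T i) \<subseteq> affine_forms"
    and dvd: "m ^ Suc v dvd (\<Sum>i\<in>S. scale (c i) (\<Prod>x\<in>#T i. h x))"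
  shows "\<exists>W' h'. degeneration U (vs.span (insert m I)) W' h' \<and>
    (\<Sum>i | i \<in> S \<and> vs.coset_count {0} (image_mset h (T i)) m = v.
        scale (c i) (\<Prod>x\<in>#T i. h' x)) = 0"
proof -
  interpret degeneration U I W h by (fact deg)
  have spanU: "vs.span U = U" by (rule vs.span_eq_iff[THEN iffD2, OF subspace_U])
  have mA: "m \<in> affine_forms" using mW W_affine by blast
  have UA: "U \<subseteq> affine_forms" using U_sub_W W_affine by blast
  have m0: "m \<noteq> 0" using mU subspace_U vs.subspace_0 by blast
  obtain \<psi> :: "('n, 'a) mpoly \<Rightarrow> ('n, 'a) mpoly" where
    add: "\<And>p q. \<psi> (p + q) = \<psi> p + \<psi> q" and mult: "\<And>p q. \<psi> (p * q) = \<psi> p * \<psi> q"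
    and Const: "\<And>c. \<psi> (Const c) = Const c" and psi_m: "\<psi> m = 0"
    and psi_U: "\<And>u. u \<in> U \<Longrightarrow> \<psi> u = u"
    and psi_affine: "\<And>x. x \<in> affine_forms \<Longrightarrow> \<exists>c. \<psi> x = x - scale c m"
    by (rule exists_elimination_hom[of U m, unfolded spanU, OF one mA mU UA]) (rule that)
  have psi_scale: "\<psi> (scale c x) = scale c (\<psi> x)" for c x
    by (simp add: scale_def mult Const)
  have psi_0: "\<psi> 0 = 0" and psi_1: "\<psi> 1 = 1" using Const[of 0] Const[of 1] by simp_all
  have psi_diff: "\<psi> (p - q) = \<psi> p - \<psi> q" for p q
    using add[of "p - q" q] by (simp add: algebra_simps)
  have psi_sum: "\<psi> (sum f A) = (\<Sum>a\<in>A. \<psi> (f a))" for f :: "nat \<Rightarrow> _" and A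
    by (induction A rule: infinite_finite_induct) (simp_all add: add psi_0)
  have psi_power: "\<psi> (p ^ n) = \<psi> p ^ n" for p n
    by (induction n) (simp_all add: psi_1 mult)
  \<comment> \<open>\<open>L\<close> is the line of \<open>m\<close>, and \<open>coef\<close> reads
    off \<open>a\<close> from \<open>a m\<close>. Sending such a form to the constant
    \<open>a\<close> instead of zero keeps \<open>h'\<close> from killing nonzero forms.\<close>
  define L where "L = vs.proj_coset {0} m"
  define coef where "coef y = (SOME a. y = scale a m)" for y
  define h' where "h' x = (if h x \<in> L then Const (coef (h x)) else \<psi> (h x))" for x
  have coef: "coef (scale a m) = a" for a
    unfolding coef_def using m0 by (intro some_equality) (auto simp: vs.scale_right_imp_eq)
  have LI: "y \<in> L \<longleftrightarrow> (\<exists>a. a \<noteq> 0 \<and> y = scale a m)" for y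
    by (simp add: L_def vs.proj_coset_zero_iff)
  have psi_W: "\<psi> y \<in> W" if y: "y \<in> W" for y
  proof -
    obtain c where "\<psi> y = y - scale c m" using psi_affine W_affine y by blast
    then show ?thesis
      using y mW by (simp add: vs.subspace_diff vs.subspace_scale subspace_W)
  qed
  have psi_eq_0: "y = 0" if "y \<in> W" "y \<notin> L" "\<psi> y = 0" for y
  proof -
    obtain c where "\<psi> y = y - scale c m" using psi_affine W_affine \<open>y \<in> W\<close> by blast
    then have "y = scale c m" using that by simp
    then show ?thesis using that LI[of y] by (cases "c = 0") auto
  qed
  define I' where "I' = vs.span (insert m I)"
  have I'_iff: "x \<in> I' \<longleftrightarrow> (\<exists>c. x - scale c m \<in> I)" for x
    unfolding I'_def vs.span_breakdown_eq vs.span_eq_iff[THEN iffD2, OF subspace_I] ..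
  have I_I': "I \<subseteq> I'" unfolding I'_def using vs.span_superset by blast
  have m_I': "m \<in> I'" unfolding I'_def by (simp add: vs.span_base)
  have sI': "vs.subspace I'" unfolding I'_def by (rule vs.subspace_span)
  have spanUI': "vs.span (U \<union> I) \<subseteq> vs.span (U \<union> I')"
    using I_I' by (intro vs.span_mono) auto
  have coef_scale: "coef (scale c y) = c * coef y" if y: "y \<in> L" for c y
  proof -
    obtain a where "y = scale a m" using y LI by blast
    then show ?thesis by (simp add: coef)
  qed
  have deg': "degeneration U I' (\<psi> ` W) h'"
  proof
    show "vs.subspace (\<psi> ` W)"
      unfolding vs.subspace_def
    proof (intro conjI ballI allI)
      show "0 \<in> \<psi> ` W" using vs.subspace_0[OF subspace_W] psi_0 by force
    next
      fix x y assume "x \<in> \<psi> ` W" "y \<in> \<psi> ` W"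
      then obtain a b where ab: "x = \<psi> a" "y = \<psi> b" "a \<in> W" "b \<in> W" by blast
      then have "a + b \<in> W" "x + y = \<psi> (a + b)"
        using subspace_W by (simp_all add: add vs.subspace_add)
      then show "x + y \<in> \<psi> ` W" by (rule rev_image_eqI)
    next
      fix x c assume "x \<in> \<psi> ` W"
      then obtain a where a: "x = \<psi> a" "a \<in> W" by blast
      then have "scale c a \<in> W" "scale c x = \<psi> (scale c a)"
        using subspace_W by (simp_all add: psi_scale vs.subspace_scale)
      then show "scale c x \<in> \<psi> ` W" by (rule rev_image_eqI)
    qed
    show "U \<subseteq> \<psi> ` W"
      using psi_U U_sub_W by (metis image_eqI subset_eq)
    show "\<psi> ` W \<subseteq> affine_forms" using psi_W W_affine by blast
    show "I' \<subseteq> affine_forms"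
      unfolding I'_def using I_affine mA by (intro vs.span_minimal subspace_affine_forms) auto
    \<comment> \<open>An element \<open>\<psi> w\<close> of \<open>I'\<close> also lies in
      \<open>W\<close>, so \<open>W \<inter> I \<subseteq> {0}\<close> makes it a multiple of
      \<open>m\<close>, which \<open>\<psi>\<close> kills. But \<open>\<psi>\<close> is idempotent
      on \<open>W\<close>, so the element equals its own image, zero.\<close>
    show "\<psi> ` W \<inter> I' \<subseteq> {0}"
    proof
      fix x assume "x \<in> \<psi> ` W \<inter> I'"
      then obtain w c where w: "x = \<psi> w" "w \<in> W" and c: "x - scale c m \<in> I"
        using I'_iff by blast
      have "x - scale c m \<in> W"
        using w mW by (simp add: psi_W vs.subspace_diff vs.subspace_scale subspace_W)
      then have xc: "x = scale c m" using c W_Int_I by auto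
      obtain e where e: "\<psi> w = w - scale e m" using psi_affine W_affine w by blast
      have "\<psi> x = \<psi> w" unfolding w(1) by (subst e) (simp add: psi_diff psi_scale psi_m)
      moreover have "\<psi> x = 0" using xc by (simp add: psi_scale psi_m)
      ultimately show "x \<in> {0}" using w by simp
    qed
    show "h' x \<in> \<psi> ` W" if "x \<in> affine_forms" for x
    proof (cases "h x \<in> L")
      case True
      then have "h' x = scale (coef (h x)) 1" by (simp add: h'_def scale_one)
      moreover have "scale (coef (h x)) 1 \<in> U"
        by (rule vs.subspace_scale[OF subspace_U one])
      ultimately show ?thesis using \<open>U \<subseteq> \<psi> ` W\<close> by auto
    next
      case False
      then show ?thesis using h_in_W[OF that] by (simp add: h'_def)
    qed
    show "h' (scale c x) = scale c (h' x)" if "x \<in> affine_forms" for c x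
    proof (cases "c = 0")
      case True
      have "0 \<notin> L" using m0 by (auto simp: LI)
      moreover have "h 0 = 0" using h_U vs.subspace_0[OF subspace_U] by blast
      ultimately show ?thesis
        using True by (simp add: h'_def psi_0)
    next
      case False
      have "scale c y \<in> L \<longleftrightarrow> y \<in> L" for y
      proof
        assume "scale c y \<in> L"
        then obtain a where a: "a \<noteq> 0" "scale c y = scale a m" using LI by blast
        then have "y = scale (inverse c * a) m"
          using False by (metis left_inverse vs.scale_one vs.scale_scale)
        moreover have "inverse c * a \<noteq> 0" using a False by simp
        ultimately show "y \<in> L" unfolding LI by blast
      next
        assume "y \<in> L"
        then obtain a where "a \<noteq> 0" "y = scale a m" using LI by blast
        then have "c * a \<noteq> 0" "scale c y = scale (c * a) m" using False by simp_all
        then show "scale c y \<in> L" unfolding LI by blast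
      qed
      then show ?thesis
        by (simp add: h'_def h_scale[OF that] coef_scale psi_scale scale_Const)
    qed
    show "x = 0" if x: "x \<in> affine_forms" and h'x: "h' x = 0" for x
    proof (cases "h x \<in> L")
      case True
      then obtain a where "a \<noteq> 0" "h x = scale a m" using LI by blast
      then show ?thesis using h'x True by (simp add: h'_def coef)
    next
      case False
      then have "h x = 0" using h'x psi_eq_0 h_in_W[OF x] by (simp add: h'_def)
      then show ?thesis by (rule h_eq_0[OF x])
    qed
    have UL: "u \<notin> L" if "u \<in> U" for u
    proof
      assume "u \<in> L"
      then obtain a where a: "a \<noteq> 0" "u = scale a m" using LI by blast
      have "scale (inverse a) u \<in> U" by (rule vs.subspace_scale[OF subspace_U that])
      then show False using a mU by simp
    qed
    show "h' u = u" if "u \<in> U" for u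
      using that UL by (simp add: h'_def h_U psi_U)
    show "h' x \<in> U" if x: "x \<in> affine_forms" and xs: "x \<in> vs.span (U \<union> I')" for x
    proof (cases "h x \<in> L")
      case True
      then show ?thesis
        using vs.subspace_scale[OF subspace_U one] by (simp add: h'_def flip: scale_one)
    next
      case False
      obtain u i' where ui: "x = u + i'" "u \<in> U" "i' \<in> I'"
        using xs unfolding vs.span_Un spanU I'_def vs.span_span by blast
      obtain c where c: "i' - scale c m \<in> I" using ui I'_iff by blast
      have "\<psi> (h x) \<in> U"
      proof (cases "x \<in> vs.span (U \<union> I)")
        case True
        then show ?thesis using h_in_U[OF x] psi_U by simp
      next
        case out: False
        \<comment> \<open>\<open>h x\<close> and \<open>u + c m\<close> agree modulo
          \<open>I\<close> and both lie in \<open>W\<close>, so they are equal;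
          \<open>\<psi>\<close> then removes the multiple of \<open>m\<close>.\<close>
        have "(h x - x) + (i' - scale c m) \<in> I"
          using h_cong[OF x out] c by (rule vs.subspace_add[OF subspace_I])
        then have "h x - (u + scale c m) \<in> I" using ui by (simp add: algebra_simps)
        moreover have "h x - (u + scale c m) \<in> W"
          using h_in_W[OF x] ui mW U_sub_W subspace_W
          by (intro vs.subspace_diff vs.subspace_add vs.subspace_scale) auto
        ultimately have "h x = u + scale c m" using W_Int_I by auto
        then show ?thesis using ui by (simp add: add psi_scale psi_m psi_U)
      qed
      then show ?thesis using False by (simp add: h'_def)
    qed
    show "h' x - x \<in> I'" if x: "x \<in> affine_forms" and xs: "x \<notin> vs.span (U \<union> I')" for x
    proof -
      have hx: "h x - x \<in> I'" using h_cong[OF x] xs spanUI' I_I' by blast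
      have "h x \<notin> L"
      proof
        assume "h x \<in> L"
        then have "h x \<in> I'" using LI m_I' by (auto simp: vs.subspace_scale[OF sI'])
        then have "h x - (h x - x) \<in> I'" using hx by (rule vs.subspace_diff[OF sI'])
        then show False using xs vs.span_base[of x "U \<union> I'"] by simp
      qed
      moreover obtain e where "\<psi> (h x) = h x - scale e m"
        using psi_affine h_in_W[OF x] W_affine by blast
      ultimately have "h' x - x = (h x - x) - scale e m" by (simp add: h'_def)
      then show ?thesis
        by (simp only: vs.subspace_diff[OF sI' hx vs.subspace_scale[OF sI' m_I']])
    qed
  qed (fact subspace_U sI')+
  \<comment> \<open>\<open>mu i\<close> is the number of factors of the \<open>i\<close>-th image on
    the line of \<open>m\<close>; \<open>g i\<close> is the cofactor of \<open>m ^ mu i\<close>,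
    with each factor \<open>a m\<close> replaced by \<open>a\<close>.\<close>
  define mu where "mu i = vs.coset_count {0} (image_mset h (T i)) m" for i
  define g where "g i = (\<Prod>x\<in>#T i. if h x \<in> L then Const (coef (h x)) else h x)" for i
  have factor: "(\<Prod>x\<in>#A. h x) = m ^ vs.coset_count {0} (image_mset h A) m *
      (\<Prod>x\<in>#A. if h x \<in> L then Const (coef (h x)) else h x)" for A
  proof (induction A)
    case empty
    show ?case by (simp add: vs.coset_count_def)
  next
    case (add y A)
    have "h y = m * Const (coef (h y))" if "h y \<in> L"
      using that LI[of "h y"] by (auto simp: coef) (simp add: scale_def mult.commute)
    with add show ?case
      by (auto simp: vs.coset_count_def L_def mult_ac)
  qed
  have "\<psi> (\<Prod>x\<in>#A. if h x \<in> L then Const (coef (h x)) else h x) = (\<Prod>x\<in>#A. h' x)" for A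
    by (induction A) (simp_all add: psi_1 mult h'_def Const)
  then have psi_g: "\<psi> (g i) = (\<Prod>x\<in>#T i. h' x)" for i
    by (simp add: g_def)
  have "(\<Sum>i\<in>S. scale (c i) (\<Prod>x\<in>#T i. h x)) = m ^ v * (\<Sum>i\<in>S. scale (c i) (m ^ (mu i - v) * g i))"
    unfolding sum_distrib_left
  proof (rule sum.cong[OF refl])
    fix i assume "i \<in> S"
    then have "m ^ mu i = m ^ v * m ^ (mu i - v)"
      using S(2) by (simp add: mu_def flip: power_add)
    then show "scale (c i) (\<Prod>x\<in>#T i. h x) = m ^ v * scale (c i) (m ^ (mu i - v) * g i)"
      unfolding factor mu_def[symmetric] g_def[symmetric] by (simp add: scale_def mult_ac)
  qed
  \<comment> \<open>Every term has order at least \<open>v\<close> in \<open>m\<close>. After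
    cancelling \<open>m ^ v\<close>, one factor \<open>m\<close> still divides the sum, so
    \<open>\<psi>\<close> kills it.\<close>
  with dvd have "m ^ v * m dvd m ^ v * (\<Sum>i\<in>S. scale (c i) (m ^ (mu i - v) * g i))"
    by (simp add: mult.commute)
  then have "m dvd (\<Sum>i\<in>S. scale (c i) (m ^ (mu i - v) * g i))"
    using m0 by simp
  then obtain q where "(\<Sum>i\<in>S. scale (c i) (m ^ (mu i - v) * g i)) = m * q" by (rule dvdE)
  then have "\<psi> (\<Sum>i\<in>S. scale (c i) (m ^ (mu i - v) * g i)) = 0"
    by (simp add: mult psi_m)
  then have "(\<Sum>i\<in>S. scale (c i) (0 ^ (mu i - v) * (\<Prod>x\<in>#T i. h' x))) = 0"
    by (simp add: psi_sum psi_scale mult psi_power psi_m psi_g)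
  \<comment> \<open>As \<open>0 ^ 0 = 1\<close>, the power of zero keeps exactly the terms of order
    \<open>v\<close>.\<close>
  also have "(\<Sum>i\<in>S. scale (c i) (0 ^ (mu i - v) * (\<Prod>x\<in>#T i. h' x))) =
      (\<Sum>i | i \<in> S \<and> mu i = v. scale (c i) (\<Prod>x\<in>#T i. h' x))"
  proof (rule sum.mono_neutral_cong_right[OF S(1)])
    show "\<forall>i\<in>S - {i. i \<in> S \<and> mu i = v}. scale (c i) (0 ^ (mu i - v) * (\<Prod>x\<in>#T i. h' x)) = 0"
    proof
      fix i assume "i \<in> S - {i. i \<in> S \<and> mu i = v}"
      then have "mu i \<noteq> v" "v \<le> mu i" using S(2)[of i] by (auto simp: mu_def)
      then have "mu i - v > 0" by simp
      then show "scale (c i) (0 ^ (mu i - v) * (\<Prod>x\<in>#T i. h' x)) = 0"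
        by (simp add: zero_power)
    qed
  qed auto
  finally show ?thesis
    using deg' unfolding I'_def mu_def by blast
qed

text \<open>Only the product over the representatives outside \<open>U\<close> depends on
  \<open>h\<close>, so the split can be compared for \<open>h\<close> and for the identity.\<close>

lemma prod_split_outside:
  fixes h :: "('n::{finite,linorder}, 'a::field) mpoly \<Rightarrow> ('n, 'a) mpoly"
  assumes scale: "\<And>c x. x \<in> affine_forms \<Longrightarrow> h (scale c x) = scale c (h x)"
    and U: "\<And>u. u \<in> U \<Longrightarrow> h u = u"
    and \<rho>: "\<And>x :: ('n, 'a) mpoly. x = scale (\<rho> x) (vs.line_rep x)"
    and rep: "\<And>x :: ('n, 'a) mpoly. x \<in> affine_forms \<Longrightarrow> vs.line_rep x \<in> affine_forms"
    and A: "set_mset A \<subseteq> affine_forms"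
  shows "(\<Prod>x\<in>#A. h x) = scale (\<Prod>x\<in>#filter_mset (\<lambda>x. x \<notin> U) A. \<rho> x)
      ((\<Prod>y\<in>#image_mset vs.line_rep (filter_mset (\<lambda>x. x \<notin> U) A). h y) *
       (\<Prod>x\<in>#filter_mset (\<lambda>x. x \<in> U) A. x))"
  using A
proof (induction A)
  case empty
  show ?case by simp
next
  case (add x A)
  have hx: "h x = scale (\<rho> x) (h (vs.line_rep x))"
    using add.prems rep[of x] scale[of "vs.line_rep x" "\<rho> x"] \<rho>[of x] by simp
  show ?case
  proof (cases "x \<in> U")
    case True
    with add show ?thesis by (simp add: U mult_scale_right mult_ac)
  next
    case False
    with add show ?thesis by (simp add: hx mult_scale_left mult_scale_right mult_ac)
  qed
qed

text \<open>If the terms in \<open>S\<close> were all equivalent outside \<open>U\<close>, their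
  representatives there would give a common factor. Its image under \<open>h\<close> is nonzero, so
  the remaining sum vanishes; being the same for the identity, it makes the original subsum
  vanish.\<close>

lemma degeneration_sum_eq_0_imp_unbalanced:
  fixes T :: "nat \<Rightarrow> ('n::{finite,linorder}, 'a::field) mpoly multiset"
  assumes "degeneration U I W h" and S: "finite S" "S \<noteq> {}"
    and T: "\<And>i. i \<in> S \<Longrightarrow> set_mset (T i) \<subseteq> affine_forms - {0}"
    and sum0: "(\<Sum>i\<in>S. scale (c i) (\<Prod>x\<in>#T i. h x)) = 0"
    and nz: "(\<Sum>i\<in>S. scale (c i) (\<Prod>\<^sub># (T i))) \<noteq> 0"
  shows "\<exists>i\<in>S. \<exists>j\<in>S. \<exists>x. x \<notin> U \<and> vs.coset_count {0} (T i) x \<noteq> vs.coset_count {0} (T j) x"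
proof (rule ccontr)
  interpret degeneration U I W h by fact
  assume "\<not> ?thesis"
  then have bal: "vs.coset_count {0} (T i) x = vs.coset_count {0} (T j) x"
    if "i \<in> S" "j \<in> S" "x \<notin> U" for i j x
    using that by blast
  have "\<exists>r. x = scale r (vs.line_rep x)" for x :: "('n, 'a) mpoly"
    using vs.proj_coset_sym[OF vs.subspace_single_0 vs.line_rep, of x]
    by (auto simp: vs.proj_coset_zero_iff)
  then obtain \<rho> where \<rho>: "\<And>x :: ('n, 'a) mpoly. x = scale (\<rho> x) (vs.line_rep x)" by metis
  have rep: "vs.line_rep x \<in> affine_forms" if x: "x \<in> affine_forms" for x :: "('n, 'a) mpoly"
  proof -
    obtain e where "vs.line_rep x = scale e x"
      using vs.line_rep[of x] by (auto simp: vs.proj_coset_zero_iff)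
    then show ?thesis by (simp add: vs.subspace_scale[OF subspace_affine_forms x])
  qed
  obtain i0 where i0: "i0 \<in> S" using S by blast
  define r where "r i = (\<Prod>x\<in>#filter_mset (\<lambda>x. x \<notin> U) (T i). \<rho> x)" for i
  define t where "t i = (\<Prod>x\<in>#filter_mset (\<lambda>x. x \<in> U) (T i). x)" for i
  define R where "R = image_mset vs.line_rep (filter_mset (\<lambda>x. x \<notin> U) (T i0))"
  have R: "image_mset vs.line_rep (filter_mset (\<lambda>x. x \<notin> U) (T i)) = R" if i: "i \<in> S" for i
    unfolding R_def
  proof (rule vs.image_line_rep_eqI)
    show "y \<notin> U" if "x \<notin> U" "y \<in> vs.proj_coset {0} x" for x y
      using vs.proj_coset_avoids[OF subspace_U _ that(2,1)] vs.subspace_0[OF subspace_U] by simp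
  qed (rule bal[OF i i0])
  \<comment> \<open>General in \<open>f\<close>, because it is applied both to \<open>h\<close> and
    to the identity.\<close>
  have eq: "(\<Sum>i\<in>S. scale (c i) (\<Prod>x\<in>#T i. f x)) =
      (\<Prod>y\<in>#R. f y) * (\<Sum>i\<in>S. scale (c i) (scale (r i) (t i)))"
    if f: "\<And>c x. x \<in> affine_forms \<Longrightarrow> f (scale c x) = scale c (f x)" "\<And>u. u \<in> U \<Longrightarrow> f u = u"
    for f
    unfolding sum_distrib_left
  proof (rule sum.cong[OF refl])
    fix i assume i: "i \<in> S"
    have "(\<Prod>x\<in>#T i. f x) = scale (r i) ((\<Prod>y\<in>#R. f y) * t i)"
      unfolding r_def t_def R[OF i, symmetric]
      by (rule prod_split_outside) (use f \<rho> rep T[OF i] in auto)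
    then show "scale (c i) (\<Prod>x\<in>#T i. f x) = (\<Prod>y\<in>#R. f y) * scale (c i) (scale (r i) (t i))"
      by (simp add: scale_def mult_ac)
  qed
  have "(\<Prod>y\<in>#R. h y) \<noteq> 0"
  proof
    assume "(\<Prod>y\<in>#R. h y) = 0"
    then obtain x where x: "x \<in># T i0" "h (vs.line_rep x) = 0"
      by (auto simp: prod_mset_zero_iff R_def)
    then have xA: "x \<in> affine_forms" "x \<noteq> 0" using T[OF i0] by auto
    have "vs.line_rep x = 0" by (rule h_eq_0[OF rep[OF xA(1)] x(2)])
    then show False using \<rho>[of x] xA by simp
  qed
  moreover have "(\<Prod>y\<in>#R. h y) * (\<Sum>i\<in>S. scale (c i) (scale (r i) (t i))) = 0"
    using eq[of h] sum0 h_scale h_U by simp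
  ultimately have "(\<Sum>i\<in>S. scale (c i) (scale (r i) (t i))) = 0" by simp
  then show False using eq[of "\<lambda>x. x"] nz by simp
qed

section \<open>Repeated reduction until the surviving terms agree\<close>

definition separating_match ::
  "nat \<Rightarrow> (nat \<Rightarrow> ('n::{finite,linorder}, 'a::field) mpoly multiset) \<Rightarrow> ('n, 'a) mpoly set \<Rightarrow> ('n, 'a) mpoly set \<Rightarrow> bool" where
  "separating_match k T U I \<longleftrightarrow>
     (\<exists>i<k. \<exists>j<k. (\<exists>x. x \<notin> U \<and> vs.coset_count {0} (T i) x \<noteq> vs.coset_count {0} (T j) x) \<and>
        (\<forall>x. x \<notin> vs.span (U \<union> I) \<longrightarrow> vs.coset_count I (T i) x = vs.coset_count I (T j) x))"

text \<open>Induction on the number of survivors. Each reduction adds one form to \<open>B\<close>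
  and discards at least one term, so \<open>card B + card S\<close> stays at most
  \<open>k + 1\<close>; as some term always survives, \<open>card B \<le> k\<close> at the
  end.\<close>

lemma degeneration_reduce:
  fixes T :: "nat \<Rightarrow> ('n::{finite,linorder}, 'a::field) mpoly multiset"
  assumes "degeneration U (vs.span B) W h" "1 \<in> U"
    and "S \<noteq> {}" "S \<subseteq> {..<k}" "(\<Sum>i\<in>S. scale (c i) (\<Prod>x\<in>#T i. h x)) = 0"
    and "finite B" "card B + card S \<le> k + 1" "B \<subseteq> affine_forms" "l \<in> B"
    and T: "\<And>i. i < k \<Longrightarrow> set_mset (T i) \<subseteq> affine_forms - {0}"
    and nz: "\<And>S. S \<noteq> {} \<Longrightarrow> S \<subseteq> {..<k} \<Longrightarrow> (\<Sum>i\<in>S. scale (c i) (\<Prod>\<^sub># (T i))) \<noteq> 0"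
  shows "\<exists>B'. finite B' \<and> card B' \<le> k \<and> B' \<subseteq> affine_forms \<and> l \<in> B' \<and> U \<inter> vs.span B' \<subseteq> {0} \<and>
    separating_match k T U (vs.span B')"
  using assms(1-9)
proof (induction "card S" arbitrary: S B W h rule: less_induct)
  case less
  interpret degeneration U "vs.span B" W h by (fact less.prems(1))
  have finS: "finite S" using less.prems(4) finite_subset by blast
  define mu where "mu m i = vs.coset_count {0} (image_mset h (T i)) m" for m i
  have TS: "set_mset (T i) \<subseteq> affine_forms - {0}" if "i \<in> S" for i
    using T that less.prems(4) by blast
  show ?case
  proof (cases "\<forall>m\<in>W - U. \<forall>i\<in>S. \<forall>j\<in>S. mu m i = mu m j")
    case True
    have match: "vs.coset_count (vs.span B) (T i) x = vs.coset_count (vs.span B) (T j) x"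
      if ij: "i \<in> S" "j \<in> S" and x: "x \<notin> vs.span (U \<union> vs.span B)" for i j x
    proof (rule matched_if_equal_counts[OF _ _ _ x])
      show "set_mset (T i) \<subseteq> affine_forms" "set_mset (T j) \<subseteq> affine_forms"
        using TS ij by blast+
      show "vs.coset_count {0} (image_mset h (T i)) m = vs.coset_count {0} (image_mset h (T j)) m"
        if "m \<in> W" "m \<notin> U" for m
        using True ij that unfolding mu_def by blast
    qed
    have "card S > 0" using finS less.prems(3) by (simp add: card_gt_0_iff)
    then have "card B \<le> k" using less.prems(7) by simp
    moreover have "U \<inter> vs.span B \<subseteq> {0}" using U_sub_W W_Int_I by blast
    moreover have "separating_match k T U (vs.span B)"
    proof -
      have "\<exists>i\<in>S. \<exists>j\<in>S. \<exists>x. x \<notin> U \<and>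
          vs.coset_count {0} (T i) x \<noteq> vs.coset_count {0} (T j) x"
        by (rule degeneration_sum_eq_0_imp_unbalanced[OF less.prems(1) finS less.prems(3) TS
              less.prems(5) nz[OF less.prems(3,4)]])
      then obtain i j where ij: "i \<in> S" "j \<in> S"
        "\<exists>x. x \<notin> U \<and> vs.coset_count {0} (T i) x \<noteq> vs.coset_count {0} (T j) x"
        by auto
      then have "i < k" "j < k" using less.prems(4) by auto
      then show ?thesis
        unfolding separating_match_def using match[OF ij(1,2)] ij(3) by metis
    qed
    ultimately show ?thesis using less.prems by blast
  next
    case False
    then obtain m i j where m: "m \<in> W" "m \<notin> U" and ij: "i \<in> S" "j \<in> S" "mu m i \<noteq> mu m j"
      by blast
    \<comment> \<open>The terms of lowest order \<open>v\<close> form a nonempty set, and a proper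
      one since the orders of \<open>i\<close> and \<open>j\<close> differ. Divisibility by
      \<open>m ^ Suc v\<close> is trivial because the sum is zero.\<close>
    define v where "v = Min (mu m ` S)"
    have v: "v \<le> mu m i" if "i \<in> S" for i unfolding v_def using that finS by simp
    define S' where "S' = {i \<in> S. mu m i = v}"
    have "v \<in> mu m ` S" unfolding v_def using finS less.prems(3) by (intro Min_in) auto
    then have S'0: "S' \<noteq> {}" by (auto simp: S'_def)
    have "i \<notin> S' \<or> j \<notin> S'" using ij(3) by (auto simp: S'_def)
    then have S'S: "S' \<subset> S" using ij(1,2) unfolding S'_def by blast
    have "\<exists>W' h'. degeneration U (vs.span (insert m (vs.span B))) W' h' \<and>
        (\<Sum>i | i \<in> S \<and> vs.coset_count {0} (image_mset h (T i)) m = v.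
          scale (c i) (\<Prod>x\<in>#T i. h' x)) = 0"
    proof (rule degeneration_step[OF less.prems(1,2) m finS])
      show "v \<le> vs.coset_count {0} (image_mset h (T i)) m" if "i \<in> S" for i
        using v[OF that] by (simp add: mu_def)
      show "set_mset (T i) \<subseteq> affine_forms" if "i \<in> S" for i
        using TS[OF that] by blast
    qed (simp add: less.prems(5))
    moreover have "vs.span (insert m (vs.span B)) = vs.span (insert m B)"
      by (auto simp: vs.span_breakdown_eq vs.span_span)
    ultimately obtain W' h' where W': "degeneration U (vs.span (insert m B)) W' h'"
      "(\<Sum>i\<in>S'. scale (c i) (\<Prod>x\<in>#T i. h' x)) = 0"
      unfolding S'_def mu_def by auto
    have lt: "card S' < card S" using S'S finS by (rule psubset_card_mono[rotated])
    have card: "card (insert m B) + card S' \<le> k + 1"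
      using lt less.prems(7) card_insert_le_m1[of "Suc (card B)" B m] less.prems(6)
      by (simp add: card_insert_if)
    show ?thesis
      by (rule less.hyps[OF lt W'(1) less.prems(2) S'0 _ W'(2) _ card])
        (use S'S less.prems m W_affine in auto)
  qed
qed

text \<open>The first reduction is special: the sum is only known to be divisible by
  \<open>l\<close>, so it uses \<open>m = l\<close> and order \<open>0\<close>. The survivors are
  the terms without a factor on the line of \<open>l\<close>, among them \<open>i0\<close>.\<close>

lemma exists_separating_match:
  fixes T :: "nat \<Rightarrow> ('n::{finite,linorder}, 'a::field) mpoly multiset"
  assumes U: "vs.subspace U" "U \<subseteq> affine_forms" "1 \<in> U"
    and l: "l \<in> affine_forms" "l \<notin> U" "l dvd (\<Sum>i<k. scale (c i) (\<Prod>\<^sub># (T i)))"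
    and i0: "i0 < k" "vs.coset_count {0} (T i0) l = 0"
    and T: "\<And>i. i < k \<Longrightarrow> set_mset (T i) \<subseteq> affine_forms - {0}"
    and nz: "\<And>S. S \<noteq> {} \<Longrightarrow> S \<subseteq> {..<k} \<Longrightarrow> (\<Sum>i\<in>S. scale (c i) (\<Prod>\<^sub># (T i))) \<noteq> 0"
  shows "\<exists>B. finite B \<and> card B \<le> k \<and> B \<subseteq> affine_forms \<and> l \<in> B \<and> U \<inter> vs.span B \<subseteq> {0} \<and>
    separating_match k T U (vs.span B)"
proof -
  define S where "S = {i. i \<in> {..<k} \<and> vs.coset_count {0} (image_mset id (T i)) l = 0}"
  have "\<exists>W' h'. degeneration U (vs.span (insert l {0})) W' h' \<and>
      (\<Sum>i\<in>S. scale (c i) (\<Prod>x\<in>#T i. h' x)) = 0"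
    unfolding S_def
  proof (rule degeneration_step[OF degeneration_id[OF U(1,2)] U(3) l(1,2)])
    show "set_mset (T i) \<subseteq> affine_forms" if "i \<in> {..<k}" for i
      using T that by blast
  qed (use l(3) in simp_all)
  then obtain W' h' where W': "degeneration U (vs.span {l}) W' h'"
    "(\<Sum>i\<in>S. scale (c i) (\<Prod>x\<in>#T i. h' x)) = 0"
    by (auto simp: insert_commute)
  have "card S \<le> card {..<k}" by (rule card_mono) (auto simp: S_def)
  then have card: "card {l} + card S \<le> k + 1" by simp
  have S: "S \<noteq> {}" "S \<subseteq> {..<k}" using i0 by (auto simp: S_def)
  show ?thesis
    by (rule degeneration_reduce[OF W'(1) U(3) S W'(2) _ card _ _ T nz]) (use l in auto)
qed

subsection \<open>Enlarging the space\<close>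

text \<open>Unordered pairs of distinct terms, larger index first.\<close>

definition pairs :: "nat \<Rightarrow> (nat \<times> nat) set" where
  "pairs k = (SIGMA j:{..<k}. {..<j})"

lemma finite_pairs [simp]: "finite (pairs k)"
  by (simp add: pairs_def)

lemma card_pairs: "real (card (pairs k)) = real k * (real k - 1) / 2"
proof -
  have "card (pairs k) = (\<Sum>j<k. j)" by (simp add: pairs_def)
  moreover have "real (\<Sum>j<k. j) = real k * (real k - 1) / 2"
    by (induction k) (simp_all add: field_simps)
  ultimately show ?thesis by simp
qed

text \<open>
  \<open>n\<close> counts the steps so far. Each one either merges two profiles or increases some \<open>r (j, i)\<close>,
  the exponent in the doubling bound for the two terms.
\<close>

definition growth_state ::
  "nat \<Rightarrow> nat \<Rightarrow> (nat \<Rightarrow> ('n::{finite,linorder}, 'a::field) mpoly multiset) \<Rightarrow> nat \<Rightarrow>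
    ('n, 'a) mpoly set \<Rightarrow> (nat \<times> nat \<Rightarrow> nat) \<Rightarrow> bool" where
  "growth_state k d T n B r \<longleftrightarrow>
     finite B \<and> B \<subseteq> affine_forms \<and> 1 \<in> B \<and> card B \<le> 1 + k * n \<and>
     n + card ((\<lambda>i. vs.profile (vs.span B) (T i)) ` {..<k}) \<le> k + (\<Sum>e\<in>pairs k. r e) \<and>
     (\<forall>e\<in>pairs k. 2 ^ r e \<le> 2 * d) \<and>
     (\<forall>(j, i)\<in>pairs k. \<forall>x. x \<notin> vs.span B \<longrightarrow> vs.coset_count {0} (T i) x \<noteq> vs.coset_count {0} (T j) x \<longrightarrow>
        2 ^ r (j, i) \<le> vs.coset_count (vs.span B) (T i + T j) x)"

lemma growth_state_init:
  fixes T :: "nat \<Rightarrow> ('n::{finite,linorder}, 'a::field) mpoly multiset"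
  assumes "d > 0"
  shows "growth_state k d T 0 {1} (\<lambda>_. 0)"
proof -
  have "card ((\<lambda>i. vs.profile (vs.span {1}) (T i)) ` {..<k}) \<le> k"
    using card_image_le[of "{..<k}" "\<lambda>i. vs.profile (vs.span {1}) (T i)"] by simp
  \<comment> \<open>The initial exponent \<open>0\<close> only claims that an unbalanced line
    contains a factor of one of the two terms.\<close>
  moreover have "1 \<le> vs.coset_count (vs.span {1}) (A + B) x"
    if "vs.coset_count {0} A x \<noteq> vs.coset_count {0} B x" for A B and x :: "('n, 'a) mpoly"
  proof -
    have "vs.coset_count {0} (A + B) x = vs.coset_count {0} A x + vs.coset_count {0} B x"
      by (simp add: vs.coset_count_def)
    then have "0 < vs.coset_count {0} (A + B) x" using that by linarith
    also have "\<dots> \<le> vs.coset_count (vs.span {1}) (A + B) x"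
      by (rule vs.coset_count_mono) (simp add: vs.span_zero)
    finally show ?thesis by simp
  qed
  ultimately show ?thesis
    using assms by (auto simp: growth_state_def one_in_affine_forms)
qed

text \<open>The increase of \<open>n\<close> is paid for by one profile fewer or by raising one
  exponent; \<open>Q W i j\<close> decides which.\<close>

lemma growth_state_step:
  fixes T :: "nat \<Rightarrow> ('n::{finite,linorder}, 'a::field) mpoly multiset"
  assumes gs: "growth_state k d T n B r"
    and size: "\<And>i. i < k \<Longrightarrow> size (T i) \<le> d"
    and D: "finite D" "card D \<le> k" "D \<subseteq> affine_forms" "vs.span B \<inter> vs.span D \<subseteq> {0}"
    and match: "separating_match k T (vs.span B) (vs.span D)"
  shows "\<exists>r'. growth_state k d T (Suc n) (B \<union> D) r'"
proof -
  define U where "U = vs.span B"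
  define W where "W = vs.span (B \<union> D)"
  have span: "vs.span (vs.span B \<union> vs.span D) = W"
    unfolding W_def vs.span_Un[of "vs.span B"] vs.span_Un[of B] vs.span_span ..
  have sub: "U \<subseteq> W" "vs.span D \<subseteq> W" unfolding U_def W_def by (simp_all add: vs.span_mono)
  define Q where "Q V i j \<longleftrightarrow> vs.profile V (T i) = vs.profile V (T j)" for V i j
  \<comment> \<open>A match is symmetric in its two terms, so they can be ordered to form an element
    of \<open>pairs k\<close>.\<close>
  have "\<exists>i j. j < k \<and> i < j \<and> \<not> Q U i j \<and>
      (\<forall>x. x \<notin> W \<longrightarrow> vs.coset_count (vs.span D) (T i) x = vs.coset_count (vs.span D) (T j) x)"
  proof -
    obtain i j where ij: "i < k" "j < k" "\<not> Q U i j"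
      "\<forall>x. x \<notin> W \<longrightarrow> vs.coset_count (vs.span D) (T i) x = vs.coset_count (vs.span D) (T j) x"
      using match unfolding separating_match_def span Q_def vs.profile_eq_iff U_def by blast
    have "i \<noteq> j" using ij(3) by (auto simp: Q_def)
    then consider "i < j" | "j < i" by linarith
    then show ?thesis
    proof cases
      case 1
      with ij show ?thesis by blast
    next
      case 2
      have "\<not> Q U j i" using ij(3) by (simp add: Q_def)
      with 2 ij show ?thesis by metis
    qed
  qed
  then obtain i j where ij: "j < k" "i < j" "\<not> Q U i j"
    "\<And>x. x \<notin> W \<Longrightarrow> vs.coset_count (vs.span D) (T i) x = vs.coset_count (vs.span D) (T j) x"
    by blast
  have pair: "(j, i) \<in> pairs k" using ij by (simp add: pairs_def)
  have gsD: "finite B" "B \<subseteq> affine_forms" "1 \<in> B" "card B \<le> 1 + k * n"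
    "n + card ((\<lambda>i. vs.profile U (T i)) ` {..<k}) \<le> k + (\<Sum>e\<in>pairs k. r e)"
    "\<And>e. e \<in> pairs k \<Longrightarrow> 2 ^ r e \<le> 2 * d"
    "\<And>j i x. (j, i) \<in> pairs k \<Longrightarrow> x \<notin> U \<Longrightarrow> vs.coset_count {0} (T i) x \<noteq> vs.coset_count {0} (T j) x \<Longrightarrow>
      2 ^ r (j, i) \<le> vs.coset_count U (T i + T j) x"
    using gs unfolding growth_state_def U_def by blast+
  have card: "card (B \<union> D) \<le> 1 + k * Suc n"
    using card_Un_le[of B D] gsD(4) D(2) by simp
  have old: "2 ^ r (b, a) \<le> vs.coset_count W (T a + T b) x"
    if "(b, a) \<in> pairs k" "x \<notin> W" "vs.coset_count {0} (T a) x \<noteq> vs.coset_count {0} (T b) x" for a b x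
    using gsD(7)[OF that(1) _ that(3)] that(2) sub(1) vs.coset_count_mono[OF sub(1), of "T a + T b" x]
    by (meson le_trans subsetD)
  show ?thesis
  proof (cases "Q W i j")
    case True
    have "card ((\<lambda>i. vs.profile W (T i)) ` {..<k}) < card ((\<lambda>i. vs.profile U (T i)) ` {..<k})"
      by (rule vs.card_profile_less[OF sub(1), of i _ j]) (use ij True in \<open>auto simp: Q_def\<close>)
    then have "growth_state k d T (Suc n) (B \<union> D) r"
      unfolding growth_state_def W_def[symmetric]
      using gsD(1-6) D(1,3) card old by auto
    then show ?thesis by blast
  next
    case False
    define r' where "r' = r((j, i) := Suc (r (j, i)))"
    have double: "2 * 2 ^ r (j, i) \<le> vs.coset_count W (T i + T j) x"
      if x: "x \<notin> W" "vs.coset_count {0} (T i) x \<noteq> vs.coset_count {0} (T j) x" for x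
    proof (rule vs.coset_count_doubling[OF _ _ _ sub _ x ij(4)[OF x(1)]])
      show "vs.subspace U" "vs.subspace (vs.span D)" "vs.subspace W"
        by (simp_all add: U_def W_def vs.subspace_span)
      show "U \<inter> vs.span D \<subseteq> {0}" using D(4) by (simp add: U_def)
    qed (rule gsD(7)[OF pair])
    \<comment> \<open>The pair is still inequivalent, so there is a class to which doubling applies.
      It has at most \<open>2 * d\<close> factors, which bounds the raised exponent.\<close>
    obtain x where x: "x \<notin> W" "vs.coset_count {0} (T i) x \<noteq> vs.coset_count {0} (T j) x"
      using False unfolding Q_def vs.profile_eq_iff by blast
    have "vs.coset_count W (T i + T j) x \<le> size (T i + T j)" by (rule vs.coset_count_le_size)
    also have "\<dots> \<le> 2 * d" using size[of i] size[of j] ij by simp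
    finally have bound: "2 * 2 ^ r (j, i) \<le> 2 * d" using double[OF x] by simp
    have "(\<Sum>e\<in>pairs k. r' e) = Suc (\<Sum>e\<in>pairs k. r e)"
      using pair by (simp add: r'_def sum.remove[OF finite_pairs pair])
    moreover have "card ((\<lambda>i. vs.profile W (T i)) ` {..<k}) \<le> card ((\<lambda>i. vs.profile U (T i)) ` {..<k})"
      by (rule vs.card_profile_mono[OF sub(1)])
    moreover have "2 ^ r' e \<le> 2 * d" if "e \<in> pairs k" for e
      using that gsD(6) bound by (auto simp: r'_def)
    moreover have "2 ^ r' (b, a) \<le> vs.coset_count W (T a + T b) x"
      if "(b, a) \<in> pairs k" "x \<notin> W" "vs.coset_count {0} (T a) x \<noteq> vs.coset_count {0} (T b) x" for a b x
      using that old double by (cases "(b, a) = (j, i)") (auto simp: r'_def)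
    ultimately have "growth_state k d T (Suc n) (B \<union> D) r'"
      unfolding growth_state_def W_def[symmetric]
      using gsD(1-5) D(1,3) card by auto
    then show ?thesis by blast
  qed
qed

section \<open>Bounding the number of steps and the final dimension\<close>

lemma growth_state_steps_le:
  assumes gs: "growth_state k d T n B r" and k: "k > 0" and d: "d \<ge> 2"
  shows "real n \<le> (real k - 1) + real k * (real k - 1) / 2 * (1 + log 2 d)"
proof -
  have r: "real (r e) \<le> 1 + log 2 d" if "e \<in> pairs k" for e
  proof -
    have "2 ^ r e \<le> 2 * d" using gs that by (auto simp: growth_state_def)
    then have "real (2 ^ r e) \<le> real (2 * d)" by (rule of_nat_mono)
    then have "(2::real) ^ r e \<le> 2 * real d" by simp
    then have "real (r e) \<le> log 2 (2 * real d)" by (rule le_log_of_power) simp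
    moreover have "log 2 (2 * real d) = 1 + log 2 d" using d by (subst log_mult) simp_all
    ultimately show ?thesis by simp
  qed
  \<comment> \<open>At least one profile always remains; this gives \<open>k - 1\<close> instead of
    \<open>k\<close> in the bound.\<close>
  have "(\<lambda>i. vs.profile (vs.span B) (T i)) ` {..<k} \<noteq> {}" using k by (simp add: lessThan_empty_iff)
  then have "card ((\<lambda>i. vs.profile (vs.span B) (T i)) ` {..<k}) > 0" by (simp add: card_gt_0_iff)
  moreover have "n + card ((\<lambda>i. vs.profile (vs.span B) (T i)) ` {..<k}) \<le> k + (\<Sum>e\<in>pairs k. r e)"
    using gs by (simp add: growth_state_def)
  ultimately have "n + 1 \<le> k + (\<Sum>e\<in>pairs k. r e)" by linarith
  then have "real (n + 1) \<le> real (k + (\<Sum>e\<in>pairs k. r e))" by (rule of_nat_mono)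
  also have "\<dots> = real k + (\<Sum>e\<in>pairs k. real (r e))" by simp
  also have "(\<Sum>e\<in>pairs k. real (r e)) \<le> real (card (pairs k)) * (1 + log 2 d)"
    using sum_bounded_above[of "pairs k" "\<lambda>e. real (r e)" "1 + log 2 d"] r by simp
  finally show ?thesis by (simp add: card_pairs)
qed

text \<open>Take a state with the largest possible number of steps. An element of \<open>L\<close>
  outside its span would allow one more step.\<close>

lemma exists_small_span:
  fixes T :: "nat \<Rightarrow> ('n::{finite,linorder}, 'a::field) mpoly multiset"
  assumes k: "k > 0" and d: "d \<ge> 2"
    and size: "\<And>i. i < k \<Longrightarrow> size (T i) \<le> d"
    and T: "\<And>i. i < k \<Longrightarrow> set_mset (T i) \<subseteq> affine_forms - {0}"
    and nz: "\<And>S. S \<noteq> {} \<Longrightarrow> S \<subseteq> {..<k} \<Longrightarrow> (\<Sum>i\<in>S. scale (c i) (\<Prod>\<^sub># (T i))) \<noteq> 0"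
    and L: "\<And>l. l \<in> L \<Longrightarrow> l \<in> affine_forms \<and> l dvd (\<Sum>i<k. scale (c i) (\<Prod>\<^sub># (T i))) \<and>
      (\<exists>i<k. vs.coset_count {0} (T i) l = 0)"
  shows "\<exists>B. finite B \<and> L \<subseteq> vs.span B \<and> real (card B) \<le> real k ^ 3 * log 2 d"
proof -
  define P where "P n \<longleftrightarrow> (\<exists>B r. growth_state k d T n B r)" for n
  have P0: "P 0" unfolding P_def using growth_state_init[of d k T] d by auto
  let ?b = "(real k - 1) + real k * (real k - 1) / 2 * (1 + log 2 d)"
  have bound: "n \<le> nat \<lceil>?b\<rceil>" if "P n" for n
    using that growth_state_steps_le[OF _ k d] unfolding P_def
    by (metis (no_types, lifting) of_nat_le_iff order_trans real_nat_ceiling_ge)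
  define n where "n = (GREATEST n. P n)"
  have n: "P n" "P m \<Longrightarrow> m \<le> n" for m
    unfolding n_def using GreatestI_nat[of P, OF P0 bound] Greatest_le_nat[of P m, OF _ bound] by auto
  obtain B r where gs: "growth_state k d T n B r" using n(1) by (auto simp: P_def)
  then have B: "finite B" "B \<subseteq> affine_forms" "1 \<in> B" "card B \<le> 1 + k * n"
    by (simp_all add: growth_state_def)
  have "L \<subseteq> vs.span B"
  proof
    fix l assume l: "l \<in> L"
    show "l \<in> vs.span B"
    proof (rule ccontr)
      assume lB: "l \<notin> vs.span B"
      have lA: "l \<in> affine_forms" and dvd: "l dvd (\<Sum>i<k. scale (c i) (\<Prod>\<^sub># (T i)))"
        using L[OF l] by blast+
      obtain i where i: "i < k" "vs.coset_count {0} (T i) l = 0" using L[OF l] by blast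
      have "vs.span B \<subseteq> affine_forms" by (rule vs.span_minimal[OF B(2) subspace_affine_forms])
      then have "\<exists>D. finite D \<and> card D \<le> k \<and> D \<subseteq> affine_forms \<and> l \<in> D \<and> vs.span B \<inter> vs.span D \<subseteq> {0} \<and>
          separating_match k T (vs.span B) (vs.span D)"
        by (rule exists_separating_match[OF vs.subspace_span _ vs.span_base[OF B(3)] lA lB dvd i T nz])
      then have "P (Suc n)" unfolding P_def using growth_state_step[OF gs size] by blast
      then show False using n(2) by fastforce
    qed
  qed
  moreover have "real (card B) \<le> real k ^ 3 * log 2 d"
  proof -
    define D where "D = log 2 d"
    have D1: "1 \<le> D" unfolding D_def using d by simp
    have k1: "1 \<le> real k" using k by simp
    have "real (card B) \<le> 1 + real k * real n"
      using B(4) of_nat_mono[of "card B" "1 + k * n"] by simp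
    also have "\<dots> \<le> 1 + real k * ((real k - 1) + real k * (real k - 1) / 2 * (1 + D))"
      using growth_state_steps_le[OF gs k d] unfolding D_def
      by (intro add_left_mono mult_left_mono) simp_all
    \<comment> \<open>From \<open>k \<ge> 1\<close> and \<open>D \<ge> 1\<close>:
      \<open>1 \<le> k D\<close>, \<open>k - 1 \<le> (k - 1) D\<close> and
      \<open>1 + D \<le> 2 D\<close>. The resulting terms add up exactly to
      \<open>k ^ 3 * D\<close>.\<close>
    also have "\<dots> \<le> real k * D + real k * ((real k - 1) * D + real k * (real k - 1) / 2 * (2 * D))"
      using k1 D1 mult_mono[of 1 "real k" 1 D]
      by (intro add_mono mult_left_mono) (auto simp: mult_le_cancel_left1)
    also have "\<dots> = real k ^ 3 * D" by (simp add: field_simps power3_eq_cube)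
    finally show ?thesis unfolding D_def .
  qed
  ultimately show ?thesis using B(1) by blast
qed

section \<open>From the circuit to multisets of affine forms\<close>

theorem theorem4:
  fixes C :: "('n::{finite,linorder}, 'a::field) circuit"
    and p :: "('n, 'a) mpoly"
    and k d :: nat
  assumes "SPS_circuit k d C"
    and "simple_circuit C"
    and "minimal_circuit C"
    and "p = circuit_poly C"
    and "p \<noteq> 0"
    and "d \<ge> 2"
  shows "real (rank (linear_factors p)) \<le> real k ^ 3 * log 2 (real d)"
proof -
  define c where "c i = fst (C ! i)" for i
  define T where "T i = mset (snd (C ! i))" for i
  have len: "length C = k" using assms(1) by (simp add: SPS_circuit_def)
  have term_eq: "term_poly (C ! i) = scale (c i) (\<Prod>\<^sub># (T i))" for i
    by (simp add: term_poly_def scale_def c_def T_def prod_mset_prod_list)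
  have p: "p = (\<Sum>i<k. scale (c i) (\<Prod>\<^sub># (T i)))"
    by (simp add: assms(4) circuit_poly_def len term_eq)
  have k: "k > 0" using assms(5) p by (cases k) auto
  \<comment> \<open>Proper subsums are nonzero by minimality, and the full sum is
    \<open>p\<close>.\<close>
  have nz: "(\<Sum>i\<in>S. scale (c i) (\<Prod>\<^sub># (T i))) \<noteq> 0" if "S \<noteq> {}" "S \<subseteq> {..<k}" for S
  proof (cases "S = {..<k}")
    case True
    then show ?thesis using assms(5) p by simp
  next
    case False
    then show ?thesis using assms(3) that unfolding minimal_circuit_def len term_eq by blast
  qed
  have linear: "linear_form x" if "i < k" "x \<in># T i" for i x
    using assms(1) that nth_mem[of i C] by (auto simp: SPS_circuit_def T_def len)
  have T: "set_mset (T i) \<subseteq> affine_forms - {0}" if i: "i < k" for i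
  proof -
    have "\<Prod>\<^sub># (T i) \<noteq> 0" using nz[of "{i}"] i by auto
    then have "0 \<notin># T i" by (simp add: prod_mset_zero_iff)
    then show ?thesis using linear[OF i] linear_form_in_affine_forms by auto
  qed
  have size: "size (T i) \<le> d" if "i < k" for i
    using assms(1) that nth_mem[of i C] by (auto simp: SPS_circuit_def T_def len)
  have L: "l \<in> affine_forms \<and> l dvd p \<and> (\<exists>i<k. vs.coset_count {0} (T i) l = 0)"
    if l: "l \<in> linear_factors p" for l
  proof (intro conjI)
    show "l \<in> affine_forms" "l dvd p"
      using l total_degree_one_in_affine_forms by (auto simp: linear_factors_def)
    have l0: "l \<noteq> 0" using l by (auto simp: linear_factors_def)
    show "\<exists>i<k. vs.coset_count {0} (T i) l = 0"
    proof (rule ccontr)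
      \<comment> \<open>Then every term has a factor that is a nonzero multiple of \<open>l\<close>.
        Such a factor is homogeneous, so \<open>l\<close> is itself a linear form dividing all
        terms, against simplicity.\<close>
      assume "\<not> ?thesis"
      then have "\<exists>x. x \<in># T i \<and> x \<in> vs.proj_coset {0} l" if "i < k" for i
        using that by (auto simp: vs.coset_count_def filter_mset_eq_conv)
      then have ex: "\<exists>x a. x \<in># T i \<and> a \<noteq> 0 \<and> x = scale a l" if "i < k" for i
        using that unfolding vs.proj_coset_zero_iff by blast
      obtain x a where x: "x \<in># T 0" "a \<noteq> 0" "x = scale a l" using ex[OF k] by blast
      have "linear_form (scale (inverse a) x)" by (rule linear_form_scale[OF linear[OF k x(1)]])
      then have "linear_form l" using x by simp
      moreover have "l dvd term_poly (C ! i)" if i: "i < k" for i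
      proof -
        obtain y b where y: "y \<in># T i" "y = scale b l" using ex[OF i] by blast
        have "l dvd y" unfolding y(2) by (simp add: scale_def)
        also have "y dvd \<Prod>\<^sub># (T i)" by (rule dvd_prod_mset[OF y(1)])
        finally show ?thesis unfolding term_eq by (simp add: scale_def)
      qed
      ultimately show False using assms(2) l0 unfolding simple_circuit_def len by blast
    qed
  qed
  have "\<exists>B. finite B \<and> linear_factors p \<subseteq> vs.span B \<and> real (card B) \<le> real k ^ 3 * log 2 d"
    by (rule exists_small_span[OF k assms(6) size T nz L[unfolded p]]) (simp_all add: p)
  then obtain B where B: "finite B" "linear_factors p \<subseteq> vs.span B" "real (card B) \<le> real k ^ 3 * log 2 d"
    by blast
  have "rank (linear_factors p) \<le> card B"
    unfolding rank_def by (rule vs.dim_le_card[OF B(2,1)])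
  then show ?thesis using B(3) by linarith
qed

end
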